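(* Let $k,l$ be fixed integers and let $n\to\infty$. (1) If $l\ge 3$ and $k\ge 2$, then $ex(n,C_{2l},C_{2k})\le (1+o(1))\frac{2^{l-2}(k-1)^l}{2l}n^l$. (2) If $k>l\ge 2$, then $ex(n,C_{2l},C_{2k})\ge (1+o(1))\frac{(k-1)_l}{2l}n^l$. (3) If $l>k\ge 3$, then $ex(n,C_{2l},C_{2k})\ge (1+o(1))\frac{1}{l^l}n^l$.
   Context: $C_k$ denotes the cycle with $k$ vertices. For a graph $H$ and a family of graphs $\mathcal F$ (or a single graph $F$), $ex(n,H,\mathcal F)$ is the maximum number of (not necessarily induced) subgraphs isomorphic to $H$ in an $n$-vertex graph containing no member of $\mathcal F$ as a subgraph. For positive integers $n,l$, $(n)_l=n(n-1)\cdots(n-l+1)$. *)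

theory Defs
  imports Complex_Main
begin

definition simple_graph :: "nat \<Rightarrow> nat set set \<Rightarrow> bool" where
  "simple_graph n E \<longleftrightarrow> E \<subseteq> {e. \<exists>u v. e = {u, v} \<and> u \<noteq> v \<and> u < n \<and> v < n}"

definition cycle_edges :: "(nat \<Rightarrow> 'a) \<Rightarrow> nat \<Rightarrow> 'a set set" where
  "cycle_edges f m = (\<lambda>i. {f i, f (Suc i mod m)}) ` {..<m}"

(* the subgraphs of E isomorphic to C_m (a cycle subgraph is determined by its edge set) *)
definition cycle_copies :: "nat \<Rightarrow> 'a set set \<Rightarrow> 'a set set set" where
  "cycle_copies m E = {C. C \<subseteq> E \<and> (\<exists>f. inj_on f {..<m} \<and> C = cycle_edges f m)}"

definition ex_cyc :: "nat \<Rightarrow> nat \<Rightarrow> nat \<Rightarrow> nat" where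
  "ex_cyc n l k = Max {card (cycle_copies (2*l) E) | E. simple_graph n E \<and> cycle_copies (2*k) E = {}}"

end

theory Submission
  imports Defs
begin

text \<open>Upper bound. Let G be a C_2k-free graph on n vertices. Write a 2l-cycle as a closed walk
  a_1, ..., a_l on one of its parity classes; the number of cycles with this class is at most the
  product of the codegrees of consecutive a_i, and by AM-GM the sum of these products is at most
  R^(l-2) S, where R bounds the row sums and S is the sum of the squared codegrees. A neighbourhood
  N(v) is joined to the rest of the graph without long paths, so Erdos-Gallai gives row sum at most
  (k-1) n + 2k deg(v). Hence only boundedly many vertices are heavy (of degree more than n/q), and
  cycles with heavy vertices in both parity classes are negligible; for all others R is about
  (k-1) n. Call a pair fat if its codegree is at least 2k. Fat pairs inside N(b) contain no path on k
  vertices, which bounds by Erdos-Gallai the quadrilaterals with a fat diagonal, and there are only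
  O(e(G)) quadrilaterals with two thin diagonals. This gives S at most about (2k-3)(k-1) n^2, which is
  less than 2 (k-1)^2 n^2.

  Lower bounds. For l < k take the complete bipartite graph with parts of sizes k-1 and n-k+1; for
  l > k take a 2l-cycle and blow up every second vertex to about n/l copies.\<close>

subsection \<open>Paths in graphs with many edges\<close>

text \<open>The constant 2k-3 is 1 + 2(k-2): a squared codegree counts ordered pairs of common
  neighbours, the equal pairs give 1, and a fat diagonal in either of its two positions gives k-2.
  As 2k-3 is strictly below 2(k-1), the gap absorbs every error term once q is a large constant, so
  for all large n the bound is (k-1)^l / l times n^l with no o(1). It lies below the claimed bound
  because 2^(l-2) is at least 2 when l is at least 3. The obstacle is the term 2k deg(v) in the row
  sums: at a vertex of linear degree it is as large as the main term. At light vertices it is only a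
  1/q fraction. The walks run through one parity class, so one light class is enough; with heavy
  vertices in both classes, two vertices of the cycle have boundedly many choices and only l-1 free
  steps remain. AM-GM is applied to two consecutive steps only, since R controls the others; this
  leaves a single factor S, the one place where the fine count of quadrilaterals is needed.\<close>

lemma erdos_gallai:
  fixes R :: "'a \<Rightarrow> 'a \<Rightarrow> bool"
  assumes "finite A" and sym: "\<And>x y. R x y \<Longrightarrow> R y x" and irr: "\<And>x. \<not> R x x"
    and "\<And>xs. distinct xs \<Longrightarrow> set xs \<subseteq> A \<Longrightarrow> successively R xs \<Longrightarrow> length xs \<noteq> m"
  shows "card {(x, y). x \<in> A \<and> y \<in> A \<and> R x y} \<le> (m - 2) * card A"
  using assms(1,4)
proof (induction A rule: finite_psubset_induct)
  case (psubset A)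
  let ?P = "\<lambda>A. {(x, y). x \<in> A \<and> y \<in> A \<and> R x y}"
  let ?path = "\<lambda>xs. distinct xs \<and> set xs \<subseteq> A \<and> successively R xs"
  have finP: "finite (?P B)" if "B \<subseteq> A" for B
    by (rule finite_subset[of _ "A \<times> A"]) (use that psubset.hyps in auto)
  have IH: "card (?P B) \<le> (m - 2) * card B" if "B \<subset> A" for B
    using psubset.IH[OF that] psubset.prems that by auto
  show ?case
  proof (cases "A = {}")
    case True
    then show ?thesis by simp
  next
    case False
    then obtain a where "a \<in> A" by blast
    then have "?path [a]" by simp
    moreover have "\<forall>xs. ?path xs \<longrightarrow> length xs < Suc (card A)"
      by (metis distinct_card card_mono psubset.hyps less_Suc_eq_le)
    \<comment> \<open>All neighbours of the two ends of a longest path lie on it. Either an end has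
      few neighbours and can be deleted, or the vertices of the path carry a cycle and are cut off
      from the rest of A.\<close>
    ultimately obtain xs where xs: "?path xs" and longest: "\<And>ys. ?path ys \<Longrightarrow> length ys \<le> length xs"
      using ex_has_greatest_nat[of ?path "[a]" length "Suc (card A)"] by blast
    define r where "r = length xs"
    have "r \<ge> 1" using longest[OF \<open>?path [a]\<close>] by (simp add: r_def)
    then have ne: "xs \<noteq> []" by (auto simp: r_def)
    have rm: "r \<le> m - 1"
    proof (rule ccontr)
      assume "\<not> r \<le> m - 1"
      then have "length (take m xs) = m" by (auto simp: r_def)
      moreover have "successively R (take m xs)"
        using xs by (metis append_take_drop_id successively_append_iff)
      ultimately show False
        using psubset.prems[of "take m xs"] xs set_take_subset[of m xs] by auto
    qed
    \<comment> \<open>\<open>?P\<close> counts ordered pairs, so each edge at z is lost twice; a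
      degree of at most (m-2)/2 costs at most m-2, the share of one vertex.\<close>
    have remove: ?thesis if z: "z \<in> A" "2 * card {u \<in> A. R z u} \<le> m - 2" for z
    proof -
      let ?D = "{u \<in> A. R z u}"
      have fD: "finite ?D" using psubset.hyps by auto
      have "?P A \<subseteq> ?P (A - {z}) \<union> (Pair z ` ?D \<union> (\<lambda>u. (u, z)) ` ?D)"
        using sym by auto
      then have "card (?P A) \<le> card (?P (A - {z}) \<union> (Pair z ` ?D \<union> (\<lambda>u. (u, z)) ` ?D))"
        using finP[of "A - {z}"] fD by (intro card_mono) auto
      also have "\<dots> \<le> card (?P (A - {z})) + (card (Pair z ` ?D) + card ((\<lambda>u. (u, z)) ` ?D))"
        by (meson card_Un_le add_left_mono le_trans)
      also have "\<dots> \<le> card (?P (A - {z})) + (card ?D + card ?D)"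
        using fD by (intro add_left_mono add_mono card_image_le)
      also have "\<dots> \<le> (m - 2) * card (A - {z}) + (m - 2)"
        using IH[of "A - {z}"] z by (intro add_mono) auto
      also have "\<dots> = (m - 2) * card A"
        using z psubset.hyps card_Suc_Diff1[of A z] by (metis mult_Suc_right add.commute)
      finally show ?thesis .
    qed
    define x where "x = xs ! 0"
    define y where "y = xs ! (r - 1)"
    have xA: "x \<in> A" and yA: "y \<in> A"
      using xs ne nth_mem[of 0 xs] nth_mem[of "r - 1" xs] by (auto simp: x_def y_def r_def)
    have lasty: "last xs = y" and hdx: "hd xs = x"
      using ne by (auto simp: y_def x_def r_def last_conv_nth hd_conv_nth)
    have nbx: "u \<in> set xs" if "u \<in> A" "R x u" for u
    proof (rule ccontr)
      assume "u \<notin> set xs"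
      then have "?path (u # xs)"
        using xs that sym hdx ne by (auto simp: successively_Cons)
      then show False using longest[of "u # xs"] by auto
    qed
    have nby: "u \<in> set xs" if "u \<in> A" "R y u" for u
    proof (rule ccontr)
      assume "u \<notin> set xs"
      then have "?path (xs @ [u])"
        using xs that sym lasty ne by (auto simp: successively_append_iff)
      then show False using longest[of "xs @ [u]"] by auto
    qed
    show ?thesis
    proof (cases "2 * card {u \<in> A. R x u} \<le> m - 2 \<or> 2 * card {u \<in> A. R y u} \<le> m - 2")
      case True
      then show ?thesis using remove xA yA by blast
    next
      case False
      \<comment> \<open>Dirac's crossing argument: I and J are sets of positions among the r-1 edges
        of the path, and their sizes add up to more than m-2, hence more than r-1. So x is adjacent
        to the far end and y to the near end of one path edge.\<close>
      define I where "I = {i. i < r - 1 \<and> R x (xs ! Suc i)}"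
      define J where "J = {i. i < r - 1 \<and> R y (xs ! i)}"
      have "{u \<in> A. R x u} \<subseteq> (\<lambda>i. xs ! Suc i) ` I"
      proof
        fix u assume u: "u \<in> {u \<in> A. R x u}"
        then obtain j where j: "j < r" "u = xs ! j"
          using nbx by (auto simp: in_set_conv_nth r_def)
        have "j \<noteq> 0" using u j irr[of x] by (intro notI) (auto simp: x_def)
        then have "j - 1 \<in> I" "u = xs ! Suc (j - 1)" using u j by (auto simp: I_def)
        then show "u \<in> (\<lambda>i. xs ! Suc i) ` I" by blast
      qed
      then have cI: "card {u \<in> A. R x u} \<le> card I"
        by (intro surj_card_le) (auto simp: I_def)
      have "{u \<in> A. R y u} \<subseteq> (\<lambda>i. xs ! i) ` J"
      proof
        fix u assume u: "u \<in> {u \<in> A. R y u}"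
        then obtain j where j: "j < r" "u = xs ! j"
          using nby by (auto simp: in_set_conv_nth r_def)
        have "j \<noteq> r - 1" using u j irr[of y] by (intro notI) (auto simp: y_def)
        then show "u \<in> (\<lambda>i. xs ! i) ` J" using u j by (auto simp: J_def)
      qed
      then have cJ: "card {u \<in> A. R y u} \<le> card J"
        by (intro surj_card_le) (auto simp: J_def)
      have "I \<inter> J \<noteq> {}"
      proof
        assume "I \<inter> J = {}"
        then have "card I + card J = card (I \<union> J)"
          by (subst card_Un_disjoint) (auto simp: I_def J_def)
        also have "\<dots> \<le> card {..<r - 1}"
          by (intro card_mono) (auto simp: I_def J_def)
        finally show False using cI cJ False rm \<open>r \<ge> 1\<close> by auto
      qed
      then obtain i where i: "i < r - 1" "R x (xs ! Suc i)" "R y (xs ! i)"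
        by (auto simp: I_def J_def)
      \<comment> \<open>Reversing the part before the crossing edge gives a path on the same
        vertices from \<open>xs ! i\<close> to y. These two are adjacent, so \<open>ys\<close>
        closes to a cycle.\<close>
      define ys where "ys = rev (take (Suc i) xs) @ drop (Suc i) xs"
      have split: "xs = take (Suc i) xs @ drop (Suc i) xs" by simp
      have set_ys: "set ys = set xs"
        unfolding ys_def by (metis append_take_drop_id set_append set_rev)
      have dys: "distinct ys"
        unfolding ys_def using xs
        by (metis append_take_drop_id distinct_append distinct_rev set_rev)
      have len: "length ys = r" using i by (auto simp: ys_def r_def)
      have symrel: "(\<lambda>x y. R y x) = R" using sym by blast
      have suc2: "successively R (take (Suc i) xs)" "successively R (drop (Suc i) xs)"
        using xs split by (metis successively_append_iff)+
      have hd2: "hd (drop (Suc i) xs) = xs ! Suc i"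
        using i by (intro hd_drop_conv_nth) (auto simp: r_def)
      have last1: "last (rev (take (Suc i) xs)) = x"
        using ne by (cases xs) (auto simp: last_rev x_def)
      have sys: "successively R ys"
        unfolding ys_def successively_append_iff successively_rev symrel
        using suc2 hd2 last1 i by simp
      have hdys: "hd ys = xs ! i"
        using i by (auto simp: ys_def hd_append hd_rev last_conv_nth r_def)
      have lastys: "last ys = y"
        using i lasty by (auto simp: ys_def last_append r_def)
      \<comment> \<open>Cutting the cycle open at u and putting z in front would give a path longer
        than the longest one.\<close>
      have noleave: "\<not> R z u" if z: "z \<in> A - set xs" "u \<in> set xs" for z u
      proof
        assume "R z u"
        from z obtain j where j: "j < r" "u = ys ! j"
          using set_ys len by (metis in_set_conv_nth)
        let ?zs = "drop j ys @ take j ys"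
        have hdz: "hd ?zs = u" using j len by (simp add: hd_append hd_drop_conv_nth)
        have "successively R (take j ys)" "successively R (drop j ys)"
          using sys by (metis append_take_drop_id successively_append_iff)+
        moreover have "j = 0 \<or> R (last (drop j ys)) (hd (take j ys))"
          using lastys hdys i j len by (cases "j = 0") (auto simp: hd_take)
        ultimately have "successively R ?zs"
          unfolding successively_append_iff by (metis take0)
        moreover have "distinct ?zs"
          using dys by (metis append_take_drop_id distinct_append inf_commute)
        moreover have "set ?zs = set xs"
          using set_ys by (metis append_take_drop_id set_append sup_commute)
        moreover have "?zs \<noteq> []" using j len by auto
        ultimately have "?path (z # ?zs)"
          using xs z \<open>R z u\<close> hdz by (auto simp: successively_Cons)
        then have "length (z # ?zs) \<le> r" using longest unfolding r_def by blast
        then show False using j len by auto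
      qed
      have "?P A \<subseteq> ?P (A - set xs) \<union> ?P (set xs)"
        using noleave sym by blast
      then have "card (?P A) \<le> card (?P (A - set xs) \<union> ?P (set xs))"
        using finP[of "A - set xs"] finP[of "set xs"] xs by (intro card_mono) auto
      also have "\<dots> \<le> card (?P (A - set xs)) + card (?P (set xs))" by (rule card_Un_le)
      also have "card (?P (set xs)) \<le> card (set xs \<times> set xs - (\<lambda>x. (x, x)) ` set xs)"
        using irr by (intro card_mono) auto
      also have "\<dots> = r * r - r"
        using xs by (subst card_Diff_subset)
          (auto simp: card_image inj_on_def card_cartesian_product distinct_card r_def)
      also have "\<dots> \<le> (m - 2) * r"
      proof -
        have "r * r - r = (r - 1) * r" by (simp add: diff_mult_distrib)
        moreover have "r - 1 \<le> m - 2" using rm by simp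
        ultimately show ?thesis by (metis mult_le_mono1)
      qed
      also have "card (?P (A - set xs)) \<le> (m - 2) * card (A - set xs)"
        using xs ne by (intro IH) (auto simp: neq_Nil_conv)
      finally have "card (?P A) \<le> (m - 2) * (card (A - set xs) + r)"
        by (simp add: algebra_simps)
      moreover have "card (A - set xs) + r = card A"
        using xs psubset.hyps distinct_card[of xs] card_mono[of A "set xs"]
        by (simp add: card_Diff_subset r_def)
      ultimately show ?thesis by simp
    qed
  qed
qed

subsection \<open>Cherries in even-cycle-free graphs\<close>

locale ugraph =
  fixes V :: "'a set" and adj :: "'a \<Rightarrow> 'a \<Rightarrow> bool"
  assumes finite_V: "finite V"
    and adj_sym: "adj u v \<Longrightarrow> adj v u"
    and adj_irrefl: "\<not> adj v v"
    and adj_in_V: "adj u v \<Longrightarrow> u \<in> V"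
begin

definition nb :: "'a \<Rightarrow> 'a set" where "nb v = {u. adj v u}"

definition codeg :: "'a \<Rightarrow> 'a \<Rightarrow> nat" where "codeg a b = card (nb a \<inter> nb b)"

definition cherries :: "'a \<Rightarrow> nat" where "cherries a = (\<Sum>b\<in>V - {a}. codeg a b)"

lemma nb_iff [simp]: "u \<in> nb v \<longleftrightarrow> adj v u"
  by (simp add: nb_def)

lemma adj_in_V2: "adj u v \<Longrightarrow> v \<in> V"
  using adj_in_V adj_sym by blast

lemma nb_subset: "nb v \<subseteq> V"
  using adj_in_V2 by auto

lemma finite_nb [simp]: "finite (nb v)"
  using finite_subset nb_subset finite_V by blast

lemma card_nb_le: "card (nb v) \<le> card V"
  by (simp add: card_mono finite_V nb_subset)

lemma codeg_commute: "codeg a b = codeg b a"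
  by (simp add: codeg_def inf_commute)

lemma codeg_self: "codeg a a = card (nb a)"
  by (simp add: codeg_def)

end

locale even_cycle_free = ugraph +
  fixes k :: nat
  assumes k_ge_2: "k \<ge> 2"
    and no_cycle: "inj_on f {..<2 * k} \<Longrightarrow> (\<And>i. i < 2 * k \<Longrightarrow> adj (f i) (f (Suc i mod (2 * k)))) \<Longrightarrow> False"
begin

text \<open>Passing through v closes the path to a cycle on 2k vertices. Every forbidden
  configuration below is brought to this form: a path on 2k-1 vertices with both ends in one
  neighbourhood.\<close>

lemma no_path_between_neighbours:
  assumes inj: "inj_on f {..<2 * k - 1}"
    and adj: "\<And>i. i < 2 * k - 2 \<Longrightarrow> adj (f i) (f (Suc i))"
    and v: "\<And>i. i < 2 * k - 1 \<Longrightarrow> f i \<noteq> v"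
    and ends: "adj v (f 0)" "adj v (f (2 * k - 2))"
  shows False
proof (rule no_cycle[of "case_nat v f"])
  have v': "f i \<noteq> v" "v \<noteq> f i" if "Suc i < 2 * k" for i
  proof -
    have "i < 2 * k - 1" using that by linarith
    then show "f i \<noteq> v" "v \<noteq> f i" using v by blast+
  qed
  show "inj_on (case_nat v f) {..<2 * k}"
  proof (rule inj_onI)
    fix x y assume "x \<in> {..<2 * k}" "y \<in> {..<2 * k}" "case_nat v f x = case_nat v f y"
    then show "x = y"
      using v' inj_onD[OF inj] by (cases x; cases y) auto
  qed
next
  fix i assume i: "i < 2 * k"
  show "adj (case_nat v f i) (case_nat v f (Suc i mod (2 * k)))"
  proof (cases "Suc i = 2 * k")
    case True
    then have "i = Suc (2 * k - 2)" using k_ge_2 by auto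
    then show ?thesis using True ends(2) adj_sym by simp
  next
    case False
    then have "Suc i mod (2 * k) = Suc i" using i by simp
    then show ?thesis using False i adj[of "i - 1"] ends(1) by (auto split: nat.splits)
  qed
qed

lemma no_path_list:
  assumes "distinct xs" "length xs = 2 * k - 1" "successively adj xs" "v \<notin> set xs"
    "adj v (hd xs)" "adj v (last xs)"
  shows False
proof (rule no_path_between_neighbours[of "\<lambda>i. xs ! i" v])
  have ne: "xs \<noteq> []" using assms(2) k_ge_2 by auto
  show "inj_on ((!) xs) {..<2 * k - 1}"
    using assms(1,2) by (intro inj_on_nth) auto
  show "adj (xs ! i) (xs ! Suc i)" if "i < 2 * k - 2" for i
    using assms(2,3) that by (auto simp: successively_conv_nth)
  show "xs ! i \<noteq> v" if "i < 2 * k - 1" for i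
    using assms(2,4) that nth_mem by metis
  show "adj v (xs ! 0)" "adj v (xs ! (2 * k - 2))"
    using assms(2,5,6) ne by (auto simp: hd_conv_nth last_conv_nth numeral_2_eq_2)
qed

text \<open>Cherries at v are the edges from N(v) to vertices other than v, here split by whether
  the far end is again in N(v). Inside N(v) a path on 2k-1 vertices is forbidden, which costs at
  most 2k-3 per neighbour; the crossing edges contain no path on 2k vertices, which costs k-1 per
  vertex.\<close>

lemma cherries_le:
  "cherries v \<le> (k - 1) * card V + 2 * k * card (nb v)"
proof -
  let ?N = "nb v"
  let ?D = "SIGMA b:V - {v} - ?N. ?N \<inter> nb b"
  let ?D' = "{(x, y). x \<in> ?N \<and> y \<in> ?N \<and> adj x y}"
  have finD: "finite ?D" using finite_V by auto
  have finD': "finite ?D'" by (rule finite_subset[of _ "?N \<times> ?N"]) auto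
  have "cherries v = card (SIGMA b:V - {v}. ?N \<inter> nb b)"
    using finite_V by (simp add: cherries_def codeg_def)
  also have "(SIGMA b:V - {v}. ?N \<inter> nb b) \<subseteq> ?D' \<union> ?D"
    by auto
  then have "card (SIGMA b:V - {v}. ?N \<inter> nb b) \<le> card ?D' + card ?D"
    using finD finD' by (intro order_trans[OF card_mono card_Un_le]) auto
  also have "card ?D' \<le> (2 * k - 1 - 2) * card ?N"
  proof (rule erdos_gallai)
    show "finite ?N" by simp
    show "length xs \<noteq> 2 * k - 1" if "distinct xs" "set xs \<subseteq> ?N" "successively adj xs" for xs
    proof
      assume l: "length xs = 2 * k - 1"
      then have "xs \<noteq> []" using k_ge_2 by auto
      then have "hd xs \<in> ?N" "last xs \<in> ?N" using that(2) hd_in_set last_in_set by blast+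
      moreover have "v \<notin> set xs" using that(2) adj_irrefl by auto
      ultimately show False using no_path_list[OF that(1) l that(3), of v] by simp
    qed
  qed (use adj_sym adj_irrefl in auto)
  also have "card ?D \<le> (k - 1) * card V"
  proof -
    \<comment> \<open>Only the edges between N(v) and its complement are kept, so paths alternate
      between the two sides.\<close>
    define R where "R = (\<lambda>x y. adj x y \<and> (x \<in> ?N \<longleftrightarrow> y \<notin> ?N))"
    let ?P = "{(x, y). x \<in> V - {v} \<and> y \<in> V - {v} \<and> R x y}"
    have "card ?P \<le> (2 * k - 2) * card (V - {v})"
    proof (rule erdos_gallai)
      show "length xs \<noteq> 2 * k" if xs: "distinct xs" "set xs \<subseteq> V - {v}" "successively R xs" for xs
      proof
        assume l: "length xs = 2 * k"
        have alt: "xs ! i \<in> ?N \<longleftrightarrow> (even i = (xs ! 0 \<in> ?N))" if "i < 2 * k" for i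
          using that
        proof (induction i)
          case (Suc i)
          then have "R (xs ! i) (xs ! Suc i)" using xs(3) l by (simp add: successively_conv_nth)
          then show ?case using Suc by (auto simp: R_def)
        qed simp
        \<comment> \<open>Of 2k alternating vertices, dropping the last one or the first one leaves
          2k-1 vertices that start and end in N(v).\<close>
        define j where "j = (if xs ! 0 \<in> ?N then 0 else 1 :: nat)"
        show False
        proof (rule no_path_between_neighbours[of "\<lambda>i. xs ! (i + j)" v])
          show "inj_on (\<lambda>i. xs ! (i + j)) {..<2 * k - 1}"
            using xs(1) l by (auto simp: inj_on_def nth_eq_iff_index_eq j_def split: if_splits)
          show "adj (xs ! (i + j)) (xs ! (Suc i + j))" if "i < 2 * k - 2" for i
          proof -
            have "R (xs ! (i + j)) (xs ! Suc (i + j))"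
              using xs(3) l that by (auto simp: successively_conv_nth j_def)
            then show ?thesis by (simp add: R_def)
          qed
          show "xs ! (i + j) \<noteq> v" if "i < 2 * k - 1" for i
          proof -
            have "i + j < length xs" using that l by (auto simp: j_def)
            then show ?thesis using xs(2) nth_mem by blast
          qed
          show "adj v (xs ! (0 + j))" "adj v (xs ! (2 * k - 2 + j))"
            using alt[of j] alt[of "2 * k - 2 + j"] k_ge_2 by (auto simp: j_def)
        qed
      qed
    qed (use adj_sym adj_irrefl finite_V in \<open>auto simp: R_def\<close>)
    \<comment> \<open>Each crossing edge occurs in \<open>?P\<close> in both orders; this halves
      2k-2 to the leading constant k-1.\<close>
    moreover have "2 * card ?D \<le> card ?P"
    proof -
      have fP: "finite ?P" by (rule finite_subset[of _ "V \<times> V"]) (use finite_V in auto)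
      have "card (?D \<union> prod.swap ` ?D) = card ?D + card (prod.swap ` ?D)"
        using finD by (intro card_Un_disjoint) auto
      also have "card (prod.swap ` ?D) = card ?D"
        by (intro card_image) auto
      finally have "2 * card ?D = card (?D \<union> prod.swap ` ?D)" by simp
      also have "\<dots> \<le> card ?P"
        using adj_in_V2 adj_sym adj_irrefl fP by (intro card_mono) (auto simp: R_def)
      finally show ?thesis .
    qed
    moreover have "(2 * k - 2) * card (V - {v}) \<le> 2 * ((k - 1) * card V)"
      using card_Diff1_le[of V v] by (simp add: diff_mult_distrib2 mult.assoc[symmetric])
    ultimately show ?thesis by linarith
  qed
  also have "(2 * k - 1 - 2) * card ?N \<le> 2 * k * card ?N" by simp
  finally show ?thesis by simp
qed

end

subsection \<open>Counting quadrilaterals\<close>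

context even_cycle_free
begin

text \<open>Interleaving \<open>ws\<close> and \<open>xs\<close> gives a path on k + (k-1) vertices
  whose ends are neighbours of b, and b closes it.\<close>

lemma no_linked_path_in_nb:
  assumes ws: "distinct ws" "length ws = k" "set ws \<subseteq> nb b"
    and xs: "distinct xs" "length xs = k - 1" "set xs \<inter> set ws = {}" "b \<notin> set xs"
    and link: "\<And>i. i < k - 1 \<Longrightarrow> adj (ws ! i) (xs ! i) \<and> adj (xs ! i) (ws ! Suc i)"
  shows False
proof -
  define f where "f = (\<lambda>i. if even i then ws ! (i div 2) else xs ! (i div 2))"
  have ws_in: "ws ! i \<in> set ws" if "i < k" for i using ws(2) that by auto
  have xs_in: "xs ! i \<in> set xs" if "i < k - 1" for i using xs(2) that by auto
  have ev: "i div 2 < k" if "i < 2 * k - 1" for i using that by linarith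
  have od: "i div 2 < k - 1" if "i < 2 * k - 1" "odd i" for i
    using that by (auto elim!: oddE)
  have b: "b \<notin> set ws" using ws(3) adj_irrefl by auto
  show False
  proof (rule no_path_between_neighbours[of f b])
    show "inj_on f {..<2 * k - 1}"
    proof (rule inj_onI)
      fix i j assume ij: "i \<in> {..<2 * k - 1}" "j \<in> {..<2 * k - 1}" "f i = f j"
      then have "even i \<longleftrightarrow> even j"
        using ws_in[OF ev, of i] ws_in[OF ev, of j] xs_in[OF od, of i] xs_in[OF od, of j] xs(3)
        by (auto simp: f_def split: if_splits)
      moreover have "i div 2 = j div 2"
        using ij calculation ev[of i] ev[of j] od[of i] od[of j] ws(1,2) xs(1,2)
        by (auto simp: f_def nth_eq_iff_index_eq split: if_splits)
      ultimately show "i = j" by (metis even_two_times_div_two odd_two_times_div_two_succ)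
    qed
  next
    fix i assume i: "i < 2 * k - 2"
    show "adj (f i) (f (Suc i))"
    proof (cases "even i")
      case True
      then have "i div 2 < k - 1" using i by auto
      then show ?thesis using link True by (simp add: f_def)
    next
      case False
      then have "i div 2 < k - 1" using od[of i] i by linarith
      then show ?thesis using link False by (simp add: f_def)
    qed
  next
    fix i assume "i < 2 * k - 1"
    then show "f i \<noteq> b"
      using ws_in[OF ev, of i] xs_in[OF od, of i] xs(4) b by (auto simp: f_def)
  next
    have "(2 * k - 2) div 2 = k - 1" by simp
    then show "adj b (f 0)" "adj b (f (2 * k - 2))"
      using ws_in[of 0] ws_in[of "k - 1"] ws(3) k_ge_2 by (auto simp: f_def)
  qed
qed

text \<open>The links are chosen greedily among the common neighbours, with Z collecting the
  vertices already forbidden. Whenever Z grows by one, \<open>ws\<close> shrinks by one, so the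
  bound 2k+1 on the sum persists; while a pair remains in \<open>ws\<close>, Z has at most 2k-1
  elements and a fat pair offers a new vertex.\<close>

lemma fat_path_links:
  assumes "successively (\<lambda>w w'. codeg w w' \<ge> 2 * k) ws" "finite Z" "card Z + length ws \<le> Suc (2 * k)"
  shows "\<exists>xs. distinct xs \<and> length xs = length ws - 1 \<and> set xs \<inter> Z = {} \<and>
    (\<forall>i < length ws - 1. adj (ws ! i) (xs ! i) \<and> adj (xs ! i) (ws ! Suc i))"
  using assms
proof (induction ws arbitrary: Z rule: induct_list012)
  case (3 w w' ws)
  have "card Z < 2 * k" using 3 by simp
  also have "\<dots> \<le> card (nb w \<inter> nb w')" using 3 by (simp add: codeg_def)
  finally have "\<not> nb w \<inter> nb w' \<subseteq> Z" using card_mono[OF \<open>finite Z\<close>] by (meson not_le)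
  then obtain x where x: "adj w x" "adj w' x" "x \<notin> Z" by (meson IntD1 IntD2 nb_iff subsetI)
  have "\<exists>xs. distinct xs \<and> length xs = length (w' # ws) - 1 \<and> set xs \<inter> insert x Z = {} \<and>
    (\<forall>i < length (w' # ws) - 1. adj ((w' # ws) ! i) (xs ! i) \<and> adj (xs ! i) ((w' # ws) ! Suc i))"
    using 3 x by (intro 3) auto
  then obtain xs where xs: "distinct xs" "length xs = length (w' # ws) - 1" "set xs \<inter> insert x Z = {}"
    "\<forall>i < length (w' # ws) - 1. adj ((w' # ws) ! i) (xs ! i) \<and> adj (xs ! i) ((w' # ws) ! Suc i)"
    by blast
  show ?case
    using x xs adj_sym by (intro exI[of _ "x # xs"]) (auto simp: nth_Cons split: nat.splits)
qed auto

text \<open>A path of k vertices in the graph of fat pairs could be linked into a cycle through b.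
  Initially b and the k path vertices are forbidden, which together with the length k is exactly the
  2k+1 that the greedy choice allows.\<close>

lemma fat_pairs_in_nb:
  assumes "A \<subseteq> nb b"
  shows "card {(w, w'). w \<in> A \<and> w' \<in> A \<and> w \<noteq> w' \<and> codeg w w' \<ge> 2 * k} \<le> (k - 2) * card A"
proof (rule erdos_gallai)
  show "finite A" using assms finite_nb finite_subset by blast
  show "length ws \<noteq> k" if ws: "distinct ws" "set ws \<subseteq> A"
    "successively (\<lambda>w w'. w \<noteq> w' \<and> codeg w w' \<ge> 2 * k) ws" for ws
  proof
    assume l: "length ws = k"
    have "\<exists>xs. distinct xs \<and> length xs = length ws - 1 \<and> set xs \<inter> insert b (set ws) = {} \<and>
      (\<forall>i < length ws - 1. adj (ws ! i) (xs ! i) \<and> adj (xs ! i) (ws ! Suc i))"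
    proof (rule fat_path_links)
      show "successively (\<lambda>w w'. codeg w w' \<ge> 2 * k) ws"
        using ws(3) by (rule successively_mono) auto
      show "card (insert b (set ws)) + length ws \<le> Suc (2 * k)"
        using l card_length[of ws] card_insert_le_m1[of "Suc k" "set ws" b] by simp
    qed simp
    then show False using no_linked_path_in_nb[of ws b] ws assms l by auto
  qed
qed (auto simp: codeg_commute)

text \<open>Each opposite vertex a selects one thin pair in N(b). A path of k vertices made of
  selected pairs would be linked by the selecting vertices, which differ as the pairs differ; hence
  there are O(k deg b) selected pairs. A thin pair is selected by fewer than 2k vertices a, and each
  a lies in at most (2k)^2 of the quadruples.\<close>

lemma thin_quads_at:
  defines "T b \<equiv> {(a, w, w'). a \<in> V \<and> a \<noteq> b \<and> codeg a b < 2 * k \<and> w \<in> nb a \<inter> nb b \<and>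
    w' \<in> nb a \<inter> nb b \<and> w \<noteq> w' \<and> codeg w w' < 2 * k}"
  shows "card (T b) \<le> (2 * k)\<^sup>2 * (1 + k\<^sup>2) * card (nb b)"
proof -
  define X where "X = {a \<in> V. a \<noteq> b \<and> codeg a b < 2 * k \<and>
    (\<exists>w w'. w \<in> nb a \<inter> nb b \<and> w' \<in> nb a \<inter> nb b \<and> w \<noteq> w' \<and> codeg w w' < 2 * k)}"
  \<comment> \<open>The selecting vertices must avoid the path, which runs inside N(b). Opposite
    vertices lying in N(b) are set aside; there are at most deg b of them.\<close>
  define X0 where "X0 = X - nb b"
  have finX: "finite X" using finite_V by (simp add: X_def)
  have "\<forall>a\<in>X0. \<exists>e. \<exists>w w'. e = {w, w'} \<and> w \<in> nb a \<inter> nb b \<and> w' \<in> nb a \<inter> nb b \<and> w \<noteq> w' \<and> codeg w w' < 2 * k"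
    unfolding X0_def X_def by blast
  from bchoice[OF this] obtain pr where pr: "\<And>a. a \<in> X0 \<Longrightarrow> \<exists>w w'. pr a = {w, w'} \<and> w \<in> nb a \<inter> nb b \<and> w' \<in> nb a \<inter> nb b \<and> w \<noteq> w' \<and> codeg w w' < 2 * k"
    by blast
  \<comment> \<open>\<open>R\<close> is the graph of selected pairs, and \<open>lab\<close> names
    one vertex that selected a given pair.\<close>
  define R where "R = (\<lambda>w w'. w \<noteq> w' \<and> {w, w'} \<in> pr ` X0)"
  define lab where "lab = (\<lambda>w w'. inv_into X0 pr {w, w'})"
  have lab: "lab w w' \<in> X0 \<and> pr (lab w w') = {w, w'} \<and> adj w (lab w w') \<and> adj (lab w w') w'" if "R w w'" for w w'
  proof -
    have 1: "{w, w'} \<in> pr ` X0" using that by (simp add: R_def)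
    have 2: "lab w w' \<in> X0" "pr (lab w w') = {w, w'}"
      using inv_into_into[OF 1] f_inv_into_f[OF 1] by (auto simp: lab_def)
    then show ?thesis using pr[OF 2(1)] adj_sym by (auto simp: doubleton_eq_iff)
  qed
  let ?P = "{(w, w'). w \<in> nb b \<and> w' \<in> nb b \<and> R w w'}"
  have "card ?P \<le> (k - 2) * card (nb b)"
  proof (rule erdos_gallai)
    show "length ws \<noteq> k" if ws: "distinct ws" "set ws \<subseteq> nb b" "successively R ws" for ws
    proof
      assume l: "length ws = k"
      define xs where "xs = map (\<lambda>i. lab (ws ! i) (ws ! Suc i)) [0..<k - 1]"
      have Ri: "R (ws ! i) (ws ! Suc i)" if "i < k - 1" for i
        using ws(3) l that by (auto simp: successively_conv_nth)
      have inj: "i = j" if ij: "i < k - 1" "j < k - 1" "lab (ws ! i) (ws ! Suc i) = lab (ws ! j) (ws ! Suc j)" for i j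
      proof -
        have "{ws ! i, ws ! Suc i} = {ws ! j, ws ! Suc j}"
          using lab[OF Ri[OF ij(1)]] lab[OF Ri[OF ij(2)]] ij(3) by metis
        then show ?thesis using ws(1) l ij(1,2)
          by (auto simp: doubleton_eq_iff nth_eq_iff_index_eq)
      qed
      have X0: "set xs \<subseteq> X0" using lab[OF Ri] by (auto simp: xs_def)
      show False
      proof (rule no_linked_path_in_nb[of ws b xs])
        show "distinct xs"
          using inj by (auto simp: xs_def distinct_map inj_on_def)
        show "set xs \<inter> set ws = {}" "b \<notin> set xs"
          using X0 ws(2) by (auto simp: X0_def X_def)
        show "adj (ws ! i) (xs ! i) \<and> adj (xs ! i) (ws ! Suc i)" if "i < k - 1" for i
          using lab[OF Ri[OF that]] that by (simp add: xs_def)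
      qed (use ws l in \<open>auto simp: xs_def\<close>)
    qed
  qed (auto simp: R_def insert_commute)
  moreover have "2 * card (pr ` X0) \<le> card ?P"
  proof -
    have fin: "finite ?P" by (rule finite_subset[of _ "nb b \<times> nb b"]) auto
    let ?q = "\<lambda>(w, w'). {w, w'}"
    have "card (pr ` X0) * 2 \<le> (\<Sum>e\<in>pr ` X0. card {p \<in> ?P. ?q p = e})"
    proof (rule sum_bounded_below[of _ "2 :: nat", unfolded of_nat_id])
      fix e assume e: "e \<in> pr ` X0"
      then obtain a where a: "a \<in> X0" "e = pr a" by blast
      then obtain w w' where w: "e = {w, w'}" "w \<in> nb b" "w' \<in> nb b" "w \<noteq> w'"
        using pr[OF a(1)] by auto
      have "{(w, w'), (w', w)} \<subseteq> {p \<in> ?P. ?q p = e}"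
        using w e by (auto simp: R_def insert_commute)
      then have "card {(w, w'), (w', w)} \<le> card {p \<in> ?P. ?q p = e}"
        using fin by (intro card_mono) auto
      then show "2 \<le> card {p \<in> ?P. ?q p = e}" using w(4) by simp
    qed
    also have "\<dots> = card (\<Union>e\<in>pr ` X0. {p \<in> ?P. ?q p = e})"
      using fin finX by (intro card_UN_disjoint[symmetric]) (auto simp: X0_def)
    also have "\<dots> \<le> card ?P"
      using fin by (intro card_mono) auto
    finally show ?thesis by simp
  qed
  moreover have "card X0 \<le> 2 * k * card (pr ` X0)"
  proof -
    have "X0 = (\<Union>e\<in>pr ` X0. {a \<in> X0. pr a = e})" by auto
    then have "card X0 \<le> (\<Sum>e\<in>pr ` X0. card {a \<in> X0. pr a = e})"
      using card_UN_le[of "pr ` X0" "\<lambda>e. {a \<in> X0. pr a = e}"] finX by (simp add: X0_def)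
    also have "\<dots> \<le> card (pr ` X0) * (2 * k)"
    proof (rule sum_bounded_above[of _ _ "2 * k", unfolded of_nat_id])
      fix e assume "e \<in> pr ` X0"
      then obtain w w' where w: "e = {w, w'}" "w \<noteq> w'" "codeg w w' < 2 * k"
        using pr by (metis imageE)
      have "{a \<in> X0. pr a = e} \<subseteq> nb w \<inter> nb w'"
      proof
        fix a assume a: "a \<in> {a \<in> X0. pr a = e}"
        then have "{w, w'} \<subseteq> nb a" using pr[of a] w by auto
        then show "a \<in> nb w \<inter> nb w'" using adj_sym by auto
      qed
      then have "card {a \<in> X0. pr a = e} \<le> codeg w w'"
        unfolding codeg_def by (intro card_mono) auto
      then show "card {a \<in> X0. pr a = e} \<le> 2 * k" using w by simp
    qed
    finally show ?thesis by (simp add: mult.commute)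
  qed
  ultimately have "2 * card (pr ` X0) \<le> (k - 2) * card (nb b)" and "card X0 \<le> k * (2 * card (pr ` X0))"
    by (simp_all add: mult_ac)
  then have "card X0 \<le> k * ((k - 2) * card (nb b))"
    by (meson mult_le_mono2 le_trans)
  also have "\<dots> \<le> k\<^sup>2 * card (nb b)"
    by (simp add: power2_eq_square)
  finally have "card X0 \<le> k\<^sup>2 * card (nb b)" .
  moreover have "card X \<le> card (nb b \<union> X0)"
    using finX by (intro card_mono) (auto simp: X0_def)
  ultimately have cX: "card X \<le> (1 + k\<^sup>2) * card (nb b)"
    using card_Un_le[of "nb b" X0] by (simp add: algebra_simps)
  have "T b \<subseteq> (SIGMA a:X. (nb a \<inter> nb b) \<times> (nb a \<inter> nb b))"
    unfolding T_def X_def by auto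
  then have "card (T b) \<le> card (SIGMA a:X. (nb a \<inter> nb b) \<times> (nb a \<inter> nb b))"
    using finX by (intro card_mono) auto
  also have "\<dots> = (\<Sum>a\<in>X. codeg a b * codeg a b)"
    using finX by (simp add: codeg_def card_cartesian_product)
  also have "\<dots> \<le> card X * (2 * k)\<^sup>2"
  proof (rule sum_bounded_above[of _ _ "(2 * k)\<^sup>2", unfolded of_nat_id])
    fix a assume "a \<in> X"
    then have "codeg a b \<le> 2 * k" by (simp add: X_def)
    then show "codeg a b * codeg a b \<le> (2 * k)\<^sup>2"
      unfolding power2_eq_square by (intro mult_le_mono)
  qed
  also have "\<dots> \<le> (1 + k\<^sup>2) * card (nb b) * (2 * k)\<^sup>2"
    using cX by (intro mult_le_mono1)
  finally show ?thesis by (simp only: mult_ac)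
qed

text \<open>A squared codegree counts ordered pairs of common neighbours. Equal pairs contribute the
  codegree once, fat pairs at most k-2 times; thin pairs between a fat pair a, b are counted from
  the other diagonal, giving k-2 once more. Only quadrilaterals with both diagonals thin remain, and
  they are bounded by the degree sum.\<close>

lemma sum_codeg_square_le:
  "(\<Sum>a\<in>V. \<Sum>b\<in>V - {a}. (codeg a b)\<^sup>2) \<le>
    (2 * k - 3) * (\<Sum>a\<in>V. cherries a) + (2 * k)\<^sup>2 * (1 + k\<^sup>2) * (\<Sum>b\<in>V. card (nb b))"
proof -
  define fat where "fat = (\<lambda>A. {(w, w'). w \<in> A \<and> w' \<in> A \<and> w \<noteq> w' \<and> codeg w w' \<ge> 2 * k})"
  define thin where "thin = (\<lambda>A. {(w, w'). w \<in> A \<and> w' \<in> A \<and> w \<noteq> w' \<and> codeg w w' < 2 * k})"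
  have fin_fat: "finite (fat (nb a \<inter> nb b))" and fin_thin: "finite (thin (nb a \<inter> nb b))" for a b
    by (auto simp: fat_def thin_def intro: finite_subset[of _ "nb a \<times> nb a"])
  have sum_fat: "(\<Sum>a\<in>V. \<Sum>b\<in>V - {a}. card (fat (nb a \<inter> nb b))) \<le> (k - 2) * (\<Sum>a\<in>V. cherries a)"
    unfolding cherries_def sum_distrib_left
  proof (intro sum_mono)
    fix a b
    show "card (fat (nb a \<inter> nb b)) \<le> (k - 2) * codeg a b"
      using fat_pairs_in_nb[of "nb a \<inter> nb b" a] by (simp add: fat_def codeg_def)
  qed
  have square: "(codeg a b)\<^sup>2 \<le> codeg a b + card (fat (nb a \<inter> nb b)) + card (thin (nb a \<inter> nb b))" for a b
  proof -
    let ?A = "nb a \<inter> nb b"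
    have "?A \<times> ?A \<subseteq> (\<lambda>x. (x, x)) ` ?A \<union> fat ?A \<union> thin ?A"
      by (auto simp: fat_def thin_def)
    then have "card (?A \<times> ?A) \<le> card ((\<lambda>x. (x, x)) ` ?A \<union> fat ?A \<union> thin ?A)"
      using fin_fat fin_thin by (intro card_mono) auto
    also have "\<dots> \<le> card ((\<lambda>x. (x, x)) ` ?A) + card (fat ?A) + card (thin ?A)"
      by (meson card_Un_le add_right_mono le_trans)
    also have "card ((\<lambda>x. (x, x)) ` ?A) \<le> card ?A"
      by (intro card_image_le) auto
    finally show ?thesis by (simp add: codeg_def card_cartesian_product power2_eq_square)
  qed
  define T where "T = {(a, b, w, w'). a \<in> V \<and> b \<in> V - {a} \<and> (w, w') \<in> thin (nb a \<inter> nb b)}"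
  \<comment> \<open>\<open>T2\<close> is indexed by the thin diagonal w, w', so that the fat pair a,
    b appears among its common neighbours; \<open>T3\<close> holds the quadrilaterals with two thin
    diagonals, grouped by b.\<close>
  define T2 where "T2 = {(a, b, w, w'). w \<in> V \<and> w' \<in> V - {w} \<and> (a, b) \<in> fat (nb w \<inter> nb w')}"
  define T3 where "T3 = (SIGMA b:V. {(a, w, w'). a \<in> V \<and> a \<noteq> b \<and> codeg a b < 2 * k \<and> w \<in> nb a \<inter> nb b \<and>
    w' \<in> nb a \<inter> nb b \<and> w \<noteq> w' \<and> codeg w w' < 2 * k})"
  have finT3: "finite T3"
    by (rule finite_subset[of _ "V \<times> V \<times> V \<times> V"]) (use finite_V adj_in_V2 in \<open>auto simp: T3_def\<close>)
  have finT2: "finite T2"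
    by (rule finite_subset[of _ "V \<times> V \<times> V \<times> V"]) (use finite_V adj_in_V2 in \<open>auto simp: T2_def fat_def\<close>)
  have "(\<Sum>a\<in>V. \<Sum>b\<in>V - {a}. card (thin (nb a \<inter> nb b))) = card T"
  proof -
    have "T = (SIGMA a:V. SIGMA b:V - {a}. thin (nb a \<inter> nb b))" by (auto simp: T_def)
    then show ?thesis using finite_V fin_thin by simp
  qed
  also have "\<dots> \<le> card (T2 \<union> (\<lambda>(b, a, w, w'). (a, b, w, w')) ` T3)"
  proof (rule card_mono)
    show "T \<subseteq> T2 \<union> (\<lambda>(b, a, w, w'). (a, b, w, w')) ` T3"
    proof
      fix t assume "t \<in> T"
      then obtain a b w w' where t: "t = (a, b, w, w')" "a \<in> V" "b \<in> V" "b \<noteq> a"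
        "(w, w') \<in> thin (nb a \<inter> nb b)" unfolding T_def by auto
      show "t \<in> T2 \<union> (\<lambda>(b, a, w, w'). (a, b, w, w')) ` T3"
      proof (cases "codeg a b < 2 * k")
        case True
        then have "(b, a, w, w') \<in> T3" using t by (auto simp: T3_def thin_def)
        then show ?thesis using t(1) by force
      next
        case False
        then have "t \<in> T2" using t adj_sym adj_in_V by (auto simp: T2_def thin_def fat_def)
        then show ?thesis ..
      qed
    qed
  qed (use finT2 finT3 in auto)
  also have "\<dots> \<le> card T2 + card T3"
    by (rule order_trans[OF card_Un_le add_left_mono[OF card_image_le[OF finT3]]])
  also have "card T2 \<le> (k - 2) * (\<Sum>a\<in>V. cherries a)"
  proof -
    have "T2 = (\<lambda>(w, w', a, b). (a, b, w, w')) ` (SIGMA w:V. SIGMA w':V - {w}. fat (nb w \<inter> nb w'))"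
      by (force simp: T2_def image_iff)
    then have "card T2 \<le> card (SIGMA w:V. SIGMA w':V - {w}. fat (nb w \<inter> nb w'))"
      using finite_V fin_fat by (simp only:) (intro card_image_le finite_SigmaI, simp_all)
    also have "\<dots> = (\<Sum>w\<in>V. \<Sum>w'\<in>V - {w}. card (fat (nb w \<inter> nb w')))"
      using finite_V fin_fat by simp
    finally show ?thesis using sum_fat by simp
  qed
  also have "card T3 \<le> (2 * k)\<^sup>2 * (1 + k\<^sup>2) * (\<Sum>b\<in>V. card (nb b))"
  proof -
    have "card T3 \<le> (\<Sum>b\<in>V. (2 * k)\<^sup>2 * (1 + k\<^sup>2) * card (nb b))"
      unfolding T3_def
    proof (subst card_SigmaI)
      show "\<forall>b\<in>V. finite {(a, w, w'). a \<in> V \<and> a \<noteq> b \<and> codeg a b < 2 * k \<and> w \<in> nb a \<inter> nb b \<and>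
        w' \<in> nb a \<inter> nb b \<and> w \<noteq> w' \<and> codeg w w' < 2 * k}"
        using finite_V by (auto intro: finite_subset[of _ "V \<times> V \<times> V"] dest: adj_in_V2)
    qed (use finite_V in \<open>auto simp only: intro!: sum_mono thin_quads_at\<close>)
    then show ?thesis by (simp add: sum_distrib_left)
  qed
  finally have thin_sum: "(\<Sum>a\<in>V. \<Sum>b\<in>V - {a}. card (thin (nb a \<inter> nb b))) \<le>
    (k - 2) * (\<Sum>a\<in>V. cherries a) + (2 * k)\<^sup>2 * (1 + k\<^sup>2) * (\<Sum>b\<in>V. card (nb b))" by simp
  have "(\<Sum>a\<in>V. \<Sum>b\<in>V - {a}. (codeg a b)\<^sup>2) \<le>
    (\<Sum>a\<in>V. \<Sum>b\<in>V - {a}. codeg a b + card (fat (nb a \<inter> nb b)) + card (thin (nb a \<inter> nb b)))"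
    by (intro sum_mono square)
  also have "\<dots> = (\<Sum>a\<in>V. cherries a) + (\<Sum>a\<in>V. \<Sum>b\<in>V - {a}. card (fat (nb a \<inter> nb b)))
     + (\<Sum>a\<in>V. \<Sum>b\<in>V - {a}. card (thin (nb a \<inter> nb b)))"
    by (simp add: sum.distrib cherries_def)
  also have "\<dots> \<le> (\<Sum>a\<in>V. cherries a) + (k - 2) * (\<Sum>a\<in>V. cherries a) +
     ((k - 2) * (\<Sum>a\<in>V. cherries a) + (2 * k)\<^sup>2 * (1 + k\<^sup>2) * (\<Sum>b\<in>V. card (nb b)))"
    using sum_fat thin_sum by (intro add_mono) auto
  also have "\<dots> = (1 + (k - 2) + (k - 2)) * (\<Sum>a\<in>V. cherries a) + (2 * k)\<^sup>2 * (1 + k\<^sup>2) * (\<Sum>b\<in>V. card (nb b))"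
    by (simp add: add_mult_distrib)
  also have "1 + (k - 2) + (k - 2) = 2 * k - 3" using k_ge_2 by simp
  finally show ?thesis .
qed

end

subsection \<open>Heavy vertices and walks\<close>

lemma sum_squares_bound_nat: "2 * x * y \<le> x\<^sup>2 + y\<^sup>2" for x y :: nat
proof (cases "x \<le> y")
  case True
  then show ?thesis by (auto simp: le_iff_add power2_eq_square algebra_simps)
next
  case False
  then show ?thesis by (auto simp: not_le less_iff_Suc_add power2_eq_square algebra_simps)
qed

context even_cycle_free
begin

lemma cherries_le_uniform: "cherries v \<le> 3 * k * card V"
proof -
  have "cherries v \<le> (k - 1) * card V + 2 * k * card V"
    using cherries_le[of v] card_nb_le[of v] by (meson add_left_mono le_trans mult_le_mono2)
  also have "\<dots> \<le> k * card V + 2 * k * card V" by simp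
  finally show ?thesis by simp
qed

text \<open>The triples (a, w, b) with w adjacent to a and b are counted by the middle vertex and by
  the pair of ends; the ends with a = b give the degrees.\<close>

lemma sum_degree_square_le: "(\<Sum>w\<in>V. (card (nb w))\<^sup>2) \<le> 4 * k * (card V)\<^sup>2"
proof -
  have codeg_ind: "codeg a b = (\<Sum>w\<in>V. of_bool (adj w a) * of_bool (adj w b))" for a b
  proof -
    have "nb a \<inter> nb b = V \<inter> {w. adj w a \<and> adj w b}" using adj_sym adj_in_V2 by auto
    then show ?thesis using finite_V by (simp add: codeg_def flip: of_bool_conj)
  qed
  have card_ind': "card (nb w) = (\<Sum>a\<in>V. of_bool (adj w a))" for w
  proof -
    have "nb w = V \<inter> {a. adj w a}" using adj_in_V2 by auto
    then show ?thesis using finite_V by simp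
  qed
  have "(\<Sum>w\<in>V. (card (nb w))\<^sup>2) = (\<Sum>w\<in>V. \<Sum>a\<in>V. \<Sum>b\<in>V. of_bool (adj w a) * of_bool (adj w b))"
    by (simp only: card_ind' power2_eq_square sum_product)
  also have "\<dots> = (\<Sum>a\<in>V. \<Sum>w\<in>V. \<Sum>b\<in>V. of_bool (adj w a) * of_bool (adj w b))"
    by (rule sum.swap)
  also have "\<dots> = (\<Sum>a\<in>V. \<Sum>b\<in>V. codeg a b)"
    unfolding codeg_ind by (intro sum.cong refl sum.swap)
  also have "\<dots> = (\<Sum>a\<in>V. card (nb a) + cherries a)"
    using finite_V by (intro sum.cong refl) (simp add: cherries_def sum.remove codeg_self)
  also have "\<dots> \<le> (\<Sum>a\<in>V. card V + 3 * k * card V)"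
    by (intro sum_mono add_mono card_nb_le cherries_le_uniform)
  also have "\<dots> = (1 + 3 * k) * (card V)\<^sup>2" by (simp add: power2_eq_square algebra_simps)
  also have "\<dots> \<le> 4 * k * (card V)\<^sup>2" using k_ge_2 by (intro mult_le_mono1) simp
  finally show ?thesis .
qed

text \<open>The parameter q stays fixed while n grows: the heavy vertices are then bounded in
  number, and a light vertex contributes errors of relative size 1/q.\<close>

definition light :: "nat \<Rightarrow> 'a set" where
  "light q = {v \<in> V. card (nb v) \<le> card V div q}"

lemma card_heavy_le:
  assumes "q > 0"
  shows "card (V - light q) \<le> 4 * k * q\<^sup>2"
proof (cases "card V = 0")
  case True
  then show ?thesis using finite_V by simp
next
  case False
  have "card (V - light q) * (card V)\<^sup>2 \<le> (\<Sum>w\<in>V - light q. (q * card (nb w))\<^sup>2)"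
  proof (rule sum_bounded_below[of _ "(card V)\<^sup>2", unfolded of_nat_id])
    fix w assume "w \<in> V - light q"
    then have "card V div q < card (nb w)" by (auto simp: light_def)
    then have "card V < card (nb w) * q" using assms by (simp add: div_less_iff_less_mult)
    then show "(card V)\<^sup>2 \<le> (q * card (nb w))\<^sup>2"
      by (intro power_mono) (simp_all add: mult.commute)
  qed
  also have "\<dots> \<le> (\<Sum>w\<in>V. (q * card (nb w))\<^sup>2)"
    using finite_V by (intro sum_mono2) auto
  also have "\<dots> = q\<^sup>2 * (\<Sum>w\<in>V. (card (nb w))\<^sup>2)"
    by (simp add: power_mult_distrib sum_distrib_left)
  also have "\<dots> \<le> q\<^sup>2 * (4 * k * (card V)\<^sup>2)"
    by (intro mult_le_mono2 sum_degree_square_le)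
  finally have "card (V - light q) * (card V)\<^sup>2 \<le> (4 * k * q\<^sup>2) * (card V)\<^sup>2"
    by (simp only: mult_ac)
  then show ?thesis using False by simp
qed

lemma sum_light_heavy_le:
  fixes g :: "'a \<Rightarrow> nat"
  assumes "q > 0" and "\<And>v. v \<in> light q \<Longrightarrow> g v \<le> B" and "\<And>v. g v \<le> B'"
  shows "(\<Sum>v\<in>V. g v) \<le> card V * B + 4 * k * q\<^sup>2 * B'"
proof -
  have sub: "light q \<subseteq> V" by (auto simp: light_def)
  have "(\<Sum>v\<in>V. g v) = (\<Sum>v\<in>V - light q. g v) + (\<Sum>v\<in>light q. g v)"
    by (rule sum.subset_diff[OF sub finite_V])
  also have "\<dots> \<le> card (V - light q) * B' + card (light q) * B"
    by (intro add_mono sum_bounded_above[of _ _ B, unfolded of_nat_id] sum_bounded_above[of _ _ B', unfolded of_nat_id] assms) auto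
  also have "\<dots> \<le> 4 * k * q\<^sup>2 * B' + card V * B"
    using card_heavy_le[OF assms(1)] card_mono[OF finite_V sub] by (intro add_mono mult_le_mono1)
  finally show ?thesis by simp
qed

text \<open>This is the right side of \<open>sum_codeg_square_le\<close> after both sums are split
  into light and heavy vertices. Apart from (2k-3)(k-1) n^2, every term is linear in n or carries
  the factor \<open>card V div q\<close>.\<close>

definition quad_bound :: "nat \<Rightarrow> nat" where
  "quad_bound q = (2 * k - 3) * (card V * ((k - 1) * card V + 2 * k * (card V div q)) + 4 * k * q\<^sup>2 * (3 * k * card V))
     + (2 * k)\<^sup>2 * (1 + k\<^sup>2) * (card V * (card V div q) + 4 * k * q\<^sup>2 * card V)"

lemma cherries_light_le:
  assumes "v \<in> light q"
  shows "cherries v \<le> (k - 1) * card V + 2 * k * (card V div q)"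
  using cherries_le[of v] assms by (auto simp: light_def intro: order_trans)

lemma sum_codeg_square_le_quad_bound:
  assumes "q > 0"
  shows "(\<Sum>a\<in>V. \<Sum>b\<in>V - {a}. (codeg a b)\<^sup>2) \<le> quad_bound q"
proof -
  have "(\<Sum>a\<in>V. cherries a) \<le> card V * ((k - 1) * card V + 2 * k * (card V div q)) + 4 * k * q\<^sup>2 * (3 * k * card V)"
    by (intro sum_light_heavy_le assms cherries_light_le cherries_le_uniform)
  moreover have "(\<Sum>b\<in>V. card (nb b)) \<le> card V * (card V div q) + 4 * k * q\<^sup>2 * card V"
    by (intro sum_light_heavy_le assms card_nb_le) (simp add: light_def)
  ultimately show ?thesis
    unfolding quad_bound_def
    by (intro order_trans[OF sum_codeg_square_le] add_mono mult_le_mono2)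
qed

end

section \<open>Codegree-weighted walks along one parity class\<close>

context ugraph
begin

text \<open>Two consecutive edges of a cycle are treated as one step, weighted by the codegree, so that a
  2l-cycle becomes a closed walk with l steps on the vertices of one parity class. The set L
  restricts the vertices of that class only.\<close>

definition step :: "'a set \<Rightarrow> 'a \<Rightarrow> 'a \<Rightarrow> nat" where
  "step L a b = (if a \<in> L \<and> b \<in> L \<and> a \<noteq> b then codeg a b else 0)"

fun num_walks :: "'a set \<Rightarrow> nat \<Rightarrow> 'a \<Rightarrow> 'a \<Rightarrow> nat" where
  "num_walks L 0 a b = of_bool (a = b)"
| "num_walks L (Suc j) a b = (\<Sum>c\<in>V. step L a c * num_walks L j c b)"

text \<open>The lists also record the middle vertices, which need not lie in L, so that a cycle can
  be read off from its walk; a walk of j steps is a list of 2j+1 vertices.\<close>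

fun walks :: "'a set \<Rightarrow> nat \<Rightarrow> 'a \<Rightarrow> 'a \<Rightarrow> 'a list set" where
  "walks L 0 a b = (if a = b then {[a]} else {})"
| "walks L (Suc j) a b = (\<Union>c\<in>{c \<in> V. a \<in> L \<and> c \<in> L \<and> a \<noteq> c}. \<Union>w\<in>nb a \<inter> nb c. (\<lambda>ys. a # w # ys) ` walks L j c b)"

lemma finite_walks: "finite (walks L j a b)"
  by (induction j arbitrary: a) (auto simp: finite_V)

lemma card_walks_le: "card (walks L j a b) \<le> num_walks L j a b"
proof (induction j arbitrary: a)
  case (Suc j)
  let ?C = "{c \<in> V. a \<in> L \<and> c \<in> L \<and> a \<noteq> c}"
  have "card (walks L (Suc j) a b) \<le> (\<Sum>c\<in>?C. card (\<Union>w\<in>nb a \<inter> nb c. (\<lambda>ys. a # w # ys) ` walks L j c b))"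
    using finite_V by (simp add: card_UN_le)
  also have "\<dots> \<le> (\<Sum>c\<in>?C. codeg a c * num_walks L j c b)"
  proof (rule sum_mono)
    fix c
    have "card (\<Union>w\<in>nb a \<inter> nb c. (\<lambda>ys. a # w # ys) ` walks L j c b)
        \<le> (\<Sum>w\<in>nb a \<inter> nb c. card ((\<lambda>ys. a # w # ys) ` walks L j c b))"
      by (intro card_UN_le) simp
    also have "\<dots> \<le> (\<Sum>w\<in>nb a \<inter> nb c. num_walks L j c b)"
      by (intro sum_mono order_trans[OF card_image_le[OF finite_walks] Suc.IH])
    finally show "card (\<Union>w\<in>nb a \<inter> nb c. (\<lambda>ys. a # w # ys) ` walks L j c b) \<le> codeg a c * num_walks L j c b"
      by (simp add: codeg_def)
  qed
  also have "\<dots> = (\<Sum>c\<in>?C. step L a c * num_walks L j c b)"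
    by (intro sum.cong) (auto simp: step_def)
  also have "\<dots> \<le> (\<Sum>c\<in>V. step L a c * num_walks L j c b)"
    using finite_V by (intro sum_mono2) auto
  finally show ?case by simp
qed simp

lemma step_commute: "step L a b = step L b a"
  by (auto simp: step_def codeg_commute)

lemma sum_step_le:
  assumes "\<And>a. a \<in> L \<Longrightarrow> cherries a \<le> R"
  shows "(\<Sum>b\<in>V. step L a b) \<le> R"
proof (cases "a \<in> L")
  case True
  have "(\<Sum>b\<in>V. step L a b) = (\<Sum>b\<in>V - {a}. step L a b)"
    using finite_V by (intro sum.mono_neutral_right) (auto simp: step_def)
  also have "\<dots> \<le> cherries a"
    unfolding cherries_def by (intro sum_mono) (simp add: step_def)
  finally show ?thesis using assms[OF True] by simp
qed (simp add: step_def)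

lemma sum_num_walks_right:
  assumes "\<And>a. (\<Sum>b\<in>V. step L a b) \<le> R"
  shows "(\<Sum>b\<in>V. num_walks L j a b) \<le> R ^ j"
proof (induction j arbitrary: a)
  case 0
  have "(\<Sum>b\<in>V. num_walks L 0 a b) = card (V \<inter> {b. a = b})"
    using finite_V by simp
  also have "\<dots> \<le> card {a}" by (intro card_mono) auto
  finally show ?case by simp
next
  case (Suc j)
  have "(\<Sum>b\<in>V. num_walks L (Suc j) a b) = (\<Sum>c\<in>V. step L a c * (\<Sum>b\<in>V. num_walks L j c b))"
    by (simp add: sum_distrib_left) (rule sum.swap)
  also have "\<dots> \<le> (\<Sum>c\<in>V. step L a c * R ^ j)"
    by (intro sum_mono mult_le_mono2 Suc)
  also have "\<dots> \<le> R * R ^ j"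
    using assms[of a] by (simp flip: sum_distrib_right)
  finally show ?case by simp
qed

lemma sum_num_walks_left:
  assumes "\<And>a. (\<Sum>b\<in>V. step L a b) \<le> R"
  shows "(\<Sum>a\<in>V. num_walks L j a b) \<le> R ^ j"
proof (induction j)
  case 0
  have "(\<Sum>a\<in>V. num_walks L 0 a b) = card (V \<inter> {a. a = b})"
    using finite_V by simp
  also have "\<dots> \<le> card {b}" by (intro card_mono) auto
  finally show ?case by simp
next
  case (Suc j)
  have "(\<Sum>a\<in>V. num_walks L (Suc j) a b) = (\<Sum>c\<in>V. \<Sum>a\<in>V. step L a c * num_walks L j c b)"
    by simp (rule sum.swap)
  also have "\<dots> = (\<Sum>c\<in>V. (\<Sum>a\<in>V. step L c a) * num_walks L j c b)"
    by (simp add: sum_distrib_right step_commute)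
  also have "\<dots> \<le> (\<Sum>c\<in>V. R * num_walks L j c b)"
    by (intro sum_mono mult_le_mono1 assms)
  also have "\<dots> \<le> R * R ^ j"
    using Suc by (simp flip: sum_distrib_left)
  finally show ?case by simp
qed

text \<open>In a closed walk a, b, c, ..., a the product of the first two weights is replaced by the
  mean of their squares. Each square involves only two of the vertices a, b, c; the third one is
  free, and the remaining j steps sum over it to at most R^j, by row or by column sums.\<close>

lemma sum_closed_walks_le:
  assumes R: "\<And>a. (\<Sum>b\<in>V. step L a b) \<le> R"
  shows "(\<Sum>a\<in>V. num_walks L (j + 2) a a) \<le> R ^ j * (\<Sum>a\<in>V. \<Sum>b\<in>V - {a}. (codeg a b)\<^sup>2)"
proof -
  let ?m = "step L" and ?W = "num_walks L j"
  let ?S = "\<Sum>a\<in>V. \<Sum>b\<in>V. (?m a b)\<^sup>2"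
  have "2 * (\<Sum>a\<in>V. num_walks L (j + 2) a a) = (\<Sum>a\<in>V. \<Sum>b\<in>V. \<Sum>c\<in>V. (2 * ?m a b * ?m b c) * ?W c a)"
    by (simp add: sum_distrib_left mult_ac)
  also have "\<dots> \<le> (\<Sum>a\<in>V. \<Sum>b\<in>V. \<Sum>c\<in>V. ((?m a b)\<^sup>2 + (?m b c)\<^sup>2) * ?W c a)"
    by (intro sum_mono mult_le_mono1 sum_squares_bound_nat)
  also have "\<dots> = (\<Sum>a\<in>V. \<Sum>b\<in>V. \<Sum>c\<in>V. (?m a b)\<^sup>2 * ?W c a) + (\<Sum>a\<in>V. \<Sum>b\<in>V. \<Sum>c\<in>V. (?m b c)\<^sup>2 * ?W c a)"
    by (simp add: sum.distrib add_mult_distrib)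
  also have "(\<Sum>a\<in>V. \<Sum>b\<in>V. \<Sum>c\<in>V. (?m a b)\<^sup>2 * ?W c a) \<le> R ^ j * ?S"
  proof -
    have "(\<Sum>a\<in>V. \<Sum>b\<in>V. \<Sum>c\<in>V. (?m a b)\<^sup>2 * ?W c a) = (\<Sum>a\<in>V. \<Sum>b\<in>V. (?m a b)\<^sup>2 * (\<Sum>c\<in>V. ?W c a))"
      by (simp add: sum_distrib_left)
    also have "\<dots> \<le> (\<Sum>a\<in>V. \<Sum>b\<in>V. (?m a b)\<^sup>2 * R ^ j)"
      by (intro sum_mono mult_le_mono2 sum_num_walks_left R)
    finally show ?thesis by (simp add: sum_distrib_left mult.commute)
  qed
  also have "(\<Sum>a\<in>V. \<Sum>b\<in>V. \<Sum>c\<in>V. (?m b c)\<^sup>2 * ?W c a) \<le> R ^ j * ?S"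
  proof -
    have "(\<Sum>a\<in>V. \<Sum>b\<in>V. \<Sum>c\<in>V. (?m b c)\<^sup>2 * ?W c a) = (\<Sum>b\<in>V. \<Sum>a\<in>V. \<Sum>c\<in>V. (?m b c)\<^sup>2 * ?W c a)"
      by (rule sum.swap)
    also have "\<dots> = (\<Sum>b\<in>V. \<Sum>c\<in>V. \<Sum>a\<in>V. (?m b c)\<^sup>2 * ?W c a)"
      by (intro sum.cong refl sum.swap)
    also have "\<dots> = (\<Sum>b\<in>V. \<Sum>c\<in>V. (?m b c)\<^sup>2 * (\<Sum>a\<in>V. ?W c a))"
      by (simp add: sum_distrib_left)
    also have "\<dots> \<le> (\<Sum>b\<in>V. \<Sum>c\<in>V. (?m b c)\<^sup>2 * R ^ j)"
      by (intro sum_mono mult_le_mono2 sum_num_walks_right R)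
    finally show ?thesis by (simp add: sum_distrib_left mult.commute)
  qed
  finally have "(\<Sum>a\<in>V. num_walks L (j + 2) a a) \<le> R ^ j * ?S" by simp
  also have "?S \<le> (\<Sum>a\<in>V. \<Sum>b\<in>V - {a}. (codeg a b)\<^sup>2)"
  proof (rule sum_mono)
    fix a
    have "(\<Sum>b\<in>V. (?m a b)\<^sup>2) = (\<Sum>b\<in>V - {a}. (?m a b)\<^sup>2)"
      using finite_V by (intro sum.mono_neutral_right) (auto simp: step_def)
    also have "\<dots> \<le> (\<Sum>b\<in>V - {a}. (codeg a b)\<^sup>2)"
      by (intro sum_mono) (simp add: step_def)
    finally show "(\<Sum>b\<in>V. (?m a b)\<^sup>2) \<le> (\<Sum>b\<in>V - {a}. (codeg a b)\<^sup>2)" .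
  qed
  finally show ?thesis by simp
qed

lemma map_in_walks:
  assumes "\<And>i. i < 2 * j \<Longrightarrow> adj (f i) (f (Suc i))"
    and "\<And>i. i \<le> j \<Longrightarrow> f (2 * i) \<in> L" and "\<And>i. i < j \<Longrightarrow> f (2 * i) \<noteq> f (2 * i + 2)"
    and "f (2 * j) \<in> V"
  shows "map f [0..<2 * j + 1] \<in> walks L j (f 0) (f (2 * j))"
  using assms
proof (induction j arbitrary: f)
  case (Suc j)
  let ?g = "\<lambda>i. f (i + 2)"
  have IH: "map ?g [0..<2 * j + 1] \<in> walks L j (?g 0) (?g (2 * j))"
    using Suc.prems(1) Suc.prems(2,3)[of "Suc _"] Suc.prems(4) by (intro Suc.IH) auto
  have split: "map f [0..<2 * Suc j + 1] = f 0 # f 1 # map ?g [0..<2 * j + 1]"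
    by (simp add: map_upt_Suc del: upt_Suc)
  have a: "adj (f 0) (f 1)" "adj (f 1) (f 2)"
    using Suc.prems(1)[of 0] Suc.prems(1)[of 1] by (auto simp: numeral_2_eq_2)
  then have "f 2 \<in> {c \<in> V. f 0 \<in> L \<and> c \<in> L \<and> f 0 \<noteq> c}"
    using Suc.prems(3)[of 0] Suc.prems(2)[of 0] Suc.prems(2)[of 1] adj_in_V2
    by (auto simp: numeral_2_eq_2)
  moreover have "f 1 \<in> nb (f 0) \<inter> nb (f 2)" using a adj_sym by simp
  moreover have "map ?g [0..<2 * j + 1] \<in> walks L j (f 2) (f (2 * Suc j))" using IH by (simp add: numeral_2_eq_2)
  ultimately show ?case unfolding split walks.simps by blast
qed simp

end

subsection \<open>Cycles as closed walks\<close>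

text \<open>Cyclic indexing by integers turns rotations and reflections into affine substitutions
  without wrap-around cases.\<close>

definition per :: "(nat \<Rightarrow> 'a) \<Rightarrow> nat \<Rightarrow> int \<Rightarrow> 'a" where
  "per f m x = f (nat (x mod int m))"

text \<open>The dihedral symmetries of the cycle: c is the new starting position, and s = 1 or s =
  -1 the direction.\<close>

definition reparam :: "(nat \<Rightarrow> 'a) \<Rightarrow> nat \<Rightarrow> int \<Rightarrow> int \<Rightarrow> nat \<Rightarrow> 'a" where
  "reparam f m c s i = per f m (c + s * int i)"

lemma per_of_nat: "i < m \<Longrightarrow> per f m (int i) = f i"
  by (simp add: per_def)

lemma per_cong: "x mod int m = y mod int m \<Longrightarrow> per f m x = per f m y"
  by (simp add: per_def)

lemma cycle_edges_per:
  assumes "m > 0"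
  shows "cycle_edges f m = range (\<lambda>x. {per f m x, per f m (x + 1)})"
proof -
  have edge: "{f i, f (Suc i mod m)} = {per f m (int i), per f m (int i + 1)}" if "i < m" for i
  proof -
    have "(int i + 1) mod int m = int (Suc i mod m)"
      by (simp add: zmod_int add.commute)
    then show ?thesis using that by (simp add: per_of_nat) (simp add: per_def)
  qed
  have "\<exists>i<m. {per f m x, per f m (x + 1)} = {per f m (int i), per f m (int i + 1)}" for x
    using assms by (intro exI[of _ "nat (x mod int m)"]) (auto simp: per_def mod_simps nat_less_iff)
  then have "range (\<lambda>x. {per f m x, per f m (x + 1)}) \<subseteq> (\<lambda>i. {per f m (int i), per f m (int i + 1)}) ` {..<m}"
    by (intro image_subsetI) blast
  moreover have "cycle_edges f m = (\<lambda>i. {per f m (int i), per f m (int i + 1)}) ` {..<m}"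
    unfolding cycle_edges_def using edge by (intro image_cong) auto
  ultimately show ?thesis by blast
qed

lemma per_reparam: "per (reparam f m c s) m x = per f m (c + s * x)" if "m > 0"
proof -
  have "(c + s * (x mod int m)) mod int m = (c + s * x) mod int m"
    by (metis mod_add_right_eq mod_mult_right_eq)
  then show ?thesis using that by (simp add: reparam_def per_def)
qed

lemma cycle_edges_reparam:
  assumes "m > 0" "s = 1 \<or> s = -1"
  shows "cycle_edges (reparam f m c s) m = cycle_edges f m"
proof -
  have "range (\<lambda>x. {per f m (c + s * x), per f m (c + s * (x + 1))}) = range (\<lambda>x. {per f m x, per f m (x + 1)})"
  proof (cases "s = 1")
    case True
    have "range (\<lambda>x. {per f m (c + s * x), per f m (c + s * (x + 1))})
        = (\<lambda>x. {per f m x, per f m (x + 1)}) ` range (\<lambda>x. c + x)"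
      unfolding image_image using True by (simp add: add.assoc)
    then show ?thesis by (simp only: surj_plus)
  next
    case False
    \<comment> \<open>Under reflection the edge from x to x+1 becomes the edge starting at c - x -
      1.\<close>
    have surj: "range (\<lambda>x. c - x - 1) = UNIV"
      by (rule surjI[of _ "\<lambda>x. c - x - 1"]) simp
    have "range (\<lambda>x. {per f m (c + s * x), per f m (c + s * (x + 1))})
        = (\<lambda>x. {per f m x, per f m (x + 1)}) ` range (\<lambda>x. c - x - 1)"
      unfolding image_image using False assms(2)
      by (intro image_cong refl) (auto simp: algebra_simps insert_commute)
    then show ?thesis by (simp only: surj)
  qed
  then show ?thesis using assms(1) by (simp add: cycle_edges_per per_reparam)
qed

lemma cycle_edges_cong: "(\<And>i. i < m \<Longrightarrow> f i = g i) \<Longrightarrow> cycle_edges f m = cycle_edges g m"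
  unfolding cycle_edges_def by (intro image_cong refl) (auto intro!: arg_cong2[of _ _ _ _ "\<lambda>a b. {a, b}"])

context ugraph
begin

definition is_cycle :: "(nat \<Rightarrow> 'a) \<Rightarrow> nat \<Rightarrow> bool" where
  "is_cycle f m \<longleftrightarrow> inj_on f {..<m} \<and> (\<forall>i<m. adj (f i) (f (Suc i mod m)))"

definition copies :: "nat \<Rightarrow> 'a set set set" where
  "copies m = {cycle_edges f m | f. is_cycle f m}"

lemma is_cycle_adj:
  assumes "is_cycle f m" "m > 0"
  shows "adj (per f m x) (per f m (x + 1))"
proof -
  let ?i = "nat (x mod int m)"
  have i: "?i < m" using assms(2) by (simp add: nat_less_iff)
  have "int (Suc ?i mod m) = (x + 1) mod int m"
    using assms(2) by (simp add: zmod_int mod_simps add.commute)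
  then have "per f m (x + 1) = f (Suc ?i mod m)" unfolding per_def by (metis nat_int)
  then show ?thesis using assms i by (simp add: is_cycle_def per_def)
qed

lemma is_cycle_per_eq_iff:
  assumes "is_cycle f m" "m > 0"
  shows "per f m x = per f m y \<longleftrightarrow> x mod int m = y mod int m"
proof
  assume "per f m x = per f m y"
  then have "nat (x mod int m) = nat (y mod int m)"
    using assms by (auto simp: is_cycle_def per_def nat_less_iff dest!: inj_onD)
  then show "x mod int m = y mod int m" using assms(2) by (simp add: eq_nat_nat_iff)
qed (rule per_cong)

lemma is_cycle_in_V: "is_cycle f m \<Longrightarrow> i < m \<Longrightarrow> f i \<in> V"
  using adj_in_V by (auto simp: is_cycle_def)

lemma is_cycle_reparam:
  assumes f: "is_cycle f m" "m > 0" and s: "s = 1 \<or> s = -1"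
  shows "is_cycle (reparam f m c s) m"
  unfolding is_cycle_def
proof (intro conjI allI impI)
  show "inj_on (reparam f m c s) {..<m}"
  proof (rule inj_onI)
    fix i j assume ij: "i \<in> {..<m}" "j \<in> {..<m}" "reparam f m c s i = reparam f m c s j"
    then have "(c + s * int i) mod int m = (c + s * int j) mod int m"
      by (simp add: reparam_def is_cycle_per_eq_iff[OF f])
    then have "int m dvd (c + s * int i) - (c + s * int j)"
      by (simp add: mod_eq_dvd_iff)
    also have "(c + s * int i) - (c + s * int j) = s * (int i - int j)" by (simp add: algebra_simps)
    finally have "int m dvd int i - int j" using s by (auto simp: dvd_diff_commute)
    then have "int i mod int m = int j mod int m" by (simp add: mod_eq_dvd_iff)
    then show "i = j" using ij by simp
  qed
next
  fix i assume "i < m"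
  let ?g = "reparam f m c s"
  have "adj (per ?g m (int i)) (per ?g m (int i + 1))"
    using s is_cycle_adj[OF f, of "c + int i"] is_cycle_adj[OF f, of "c - int i - 1"] adj_sym
    by (auto simp: per_reparam f algebra_simps)
  moreover have "per ?g m (int i) = ?g i" using \<open>i < m\<close> by (rule per_of_nat)
  moreover have "per ?g m (int i + 1) = ?g (Suc i mod m)"
  proof -
    have "(int i + 1) mod int m = int (Suc i mod m)" by (simp add: zmod_int add.commute)
    then show ?thesis by (simp add: per_def)
  qed
  ultimately show "adj (?g i) (?g (Suc i mod m))" by simp
qed

lemma per_even:
  assumes "\<And>i. i < l \<Longrightarrow> f (2 * i) \<in> L" "l > 0" "even x"
  shows "per f (2 * l) x \<in> L"
proof -
  let ?y = "x mod int (2 * l)"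
  have "even ?y" using assms(3) by (simp add: dvd_mod)
  then obtain i where i: "?y = 2 * i" by blast
  have "0 \<le> ?y" "?y < int (2 * l)" using assms(2) by simp_all
  then have "nat i < l" "nat ?y = 2 * nat i" using i by auto
  then show ?thesis using assms(1) by (simp add: per_def)
qed

definition copies_in :: "'a set \<Rightarrow> nat \<Rightarrow> 'a set set set" where
  "copies_in L l = {cycle_edges f (2 * l) | f. is_cycle f (2 * l) \<and> (\<forall>i<l. f (2 * i) \<in> L)}"

text \<open>Rotations by an even amount and reflections keep the parity class, so every cycle gives
  2l closed walks.\<close>

lemma card_copies_in_le:
  assumes "l \<ge> 2"
  shows "2 * l * card (copies_in L l) \<le> (\<Sum>a\<in>V. num_walks L l a a)"
proof -
  let ?m = "2 * l"
  define U where "U = (\<Union>a\<in>V. walks L l a a)"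
  have "\<forall>C\<in>copies_in L l. \<exists>f. is_cycle f ?m \<and> (\<forall>i<l. f (2 * i) \<in> L) \<and> C = cycle_edges f ?m"
    unfolding copies_in_def by blast
  from bchoice[OF this] obtain F where
    "\<forall>C\<in>copies_in L l. is_cycle (F C) ?m \<and> (\<forall>i<l. F C (2 * i) \<in> L) \<and> C = cycle_edges (F C) ?m" ..
  note F = bspec[OF this]
  define \<Phi> where "\<Phi> = (\<lambda>(C, j, s). map (reparam (F C) ?m (2 * int j) s) [0..<2 * l + 1])"
  let ?D = "copies_in L l \<times> {..<l} \<times> {1, -1 :: int}"
  have m0: "?m > 0" using assms by simp
  have "\<Phi> ` ?D \<subseteq> U"
  proof (rule image_subsetI)
    fix p assume "p \<in> ?D"
    then obtain C j s where p: "p = (C, j, s)" and C: "C \<in> copies_in L l" and j: "j \<in> {..<l}" and s: "s \<in> {1, -1}"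
      by blast
    let ?f = "F C" and ?h = "reparam (F C) ?m (2 * int j) s"
    have f: "is_cycle ?f ?m" using F[OF C] by blast
    have adjh: "adj (?h i) (?h (Suc i))" for i
      using s is_cycle_adj[OF f m0, of "2 * int j + int i"] is_cycle_adj[OF f m0, of "2 * int j - int i - 1"] adj_sym
      by (auto simp: reparam_def algebra_simps)
    have h0: "?h (2 * l) = ?h 0"
      unfolding reparam_def by (rule per_cong) (simp add: mod_eq_dvd_iff)
    have "map ?h [0..<2 * l + 1] \<in> walks L l (?h 0) (?h (2 * l))"
    proof (rule map_in_walks)
      show "?h (2 * i) \<in> L" for i
        unfolding reparam_def using F[OF C] assms by (intro per_even) auto
      show "?h (2 * i) \<noteq> ?h (2 * i + 2)" for i
      proof
        assume "?h (2 * i) = ?h (2 * i + 2)"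
        then have "int ?m dvd (2 * int j + s * int (2 * i)) - (2 * int j + s * int (2 * i + 2))"
          by (simp only: reparam_def is_cycle_per_eq_iff[OF f m0] mod_eq_dvd_iff)
        also have "(2 * int j + s * int (2 * i)) - (2 * int j + s * int (2 * i + 2)) = - 2 * s"
          by (simp add: algebra_simps)
        finally have "int ?m dvd 2" using s by auto
        then have "int ?m \<le> 2" by (rule zdvd_imp_le) simp
        then show False using assms by simp
      qed
      show "?h (2 * l) \<in> V" using adjh adj_in_V by blast
    qed (rule adjh)
    moreover have "?h 0 \<in> V" using adjh adj_in_V by blast
    ultimately show "\<Phi> p \<in> U" unfolding U_def \<Phi>_def h0 p prod.case by blast
  qed
  moreover have "inj_on \<Phi> ?D"
  proof (rule inj_onI)
    fix p p' assume pp: "p \<in> ?D" "p' \<in> ?D" "\<Phi> p = \<Phi> p'"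
    obtain C j s where p: "p = (C, j, s)" by (metis prod_cases3)
    obtain C' j' s' where p': "p' = (C', j', s')" by (metis prod_cases3)
    have C: "C \<in> copies_in L l" "C' \<in> copies_in L l" and j: "j \<in> {..<l}" "j' \<in> {..<l}"
      and s: "s \<in> {1, -1}" "s' \<in> {1, -1}" and eq: "\<Phi> (C, j, s) = \<Phi> (C', j', s')"
      using pp unfolding p p' by blast+
    have eq': "reparam (F C) ?m (2 * int j) s i = reparam (F C') ?m (2 * int j') s' i" if "i < 2 * l + 1" for i
      using eq that by (auto simp: \<Phi>_def list_eq_iff_nth_eq simp del: upt_Suc)
    \<comment> \<open>The walk determines the edge set and hence C and its chosen parametrization.
      Its first entry then determines j, and its second entry determines s because 2l does not
      divide 2.\<close>
    have "cycle_edges (reparam (F C) ?m (2 * int j) s) ?m = cycle_edges (reparam (F C') ?m (2 * int j') s') ?m"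
      using eq' by (intro cycle_edges_cong) simp
    then have "cycle_edges (F C) ?m = cycle_edges (F C') ?m"
      using s cycle_edges_reparam[OF m0] by (metis insertE singletonD)
    then have CC: "C = C'" using F C by metis
    have f: "is_cycle (F C) ?m" using F C by blast
    have "per (F C) ?m (2 * int j) = per (F C) ?m (2 * int j')"
      using eq'[of 0] CC by (simp add: reparam_def)
    then have "(2 * int j) mod int ?m = (2 * int j') mod int ?m"
      by (rule is_cycle_per_eq_iff[OF f m0, THEN iffD1])
    then have jj: "j = j'" using j by simp
    have "per (F C) ?m (2 * int j + s) = per (F C) ?m (2 * int j + s')"
      using eq'[of 1] m0 CC jj by (simp add: reparam_def)
    then have "int ?m dvd (2 * int j + s) - (2 * int j + s')"
      unfolding is_cycle_per_eq_iff[OF f m0] mod_eq_dvd_iff .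
    then have "int ?m dvd s - s'" by simp
    moreover have "\<not> int ?m dvd 2" "\<not> int ?m dvd -2"
      using assms zdvd_imp_le[of "int ?m" 2] by auto
    ultimately have "s = s'" using s by auto
    then show "p = p'" using CC jj p p' by simp
  qed
  moreover have "finite U" using finite_V finite_walks by (simp add: U_def)
  ultimately have "card ?D \<le> card U" by (metis card_inj_on_le)
  moreover have "card ?D = 2 * l * card (copies_in L l)"
    by (simp add: card_cartesian_product)
  moreover have "card U \<le> (\<Sum>a\<in>V. num_walks L l a a)"
    unfolding U_def using finite_V
    by (intro order_trans[OF card_UN_le sum_mono] card_walks_le)
  ultimately show ?thesis by simp
qed

section \<open>Cycles meeting a small vertex set in both parity classes\<close>

definition copies_through :: "'a set \<Rightarrow> nat \<Rightarrow> 'a set set set" where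
  "copies_through H l = {cycle_edges f (2 * l) | f. is_cycle f (2 * l) \<and> f 0 \<in> H \<and> (\<exists>j<l. f (2 * j + 1) \<in> H)}"

text \<open>The even vertex f(0) and the odd vertex f(2j+1) are chosen from H. The rest is a walk of
  j steps forwards from f(0) and one of l-1-j steps backwards, both with free ends, so there are
  only l-1 factors R. With R linear in n and H bounded this is O(n^(l-1)).\<close>

lemma card_copies_through_le:
  assumes l: "l \<ge> 2" and R: "\<And>a. (\<Sum>b\<in>V. step V a b) \<le> R" and finH: "finite H"
  shows "card (copies_through H l) \<le> l * (card H)\<^sup>2 * R ^ (l - 1)"
proof -
  let ?m = "2 * l"
  have m0: "?m > 0" using assms by simp
  have "\<forall>C\<in>copies_through H l. \<exists>p. is_cycle (fst p) ?m \<and> fst p 0 \<in> H \<and> snd p < l \<and> fst p (2 * snd p + 1) \<in> H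
     \<and> C = cycle_edges (fst p) ?m"
    by (auto simp: copies_through_def)
  from bchoice[OF this] obtain P where
    P: "\<And>C. C \<in> copies_through H l \<Longrightarrow> is_cycle (fst (P C)) ?m \<and> fst (P C) 0 \<in> H \<and> snd (P C) < l \<and>
     fst (P C) (2 * snd (P C) + 1) \<in> H \<and> C = cycle_edges (fst (P C)) ?m" by blast
  define F where "F C = fst (P C)" for C
  define J where "J C = snd (P C)" for C
  have F: "is_cycle (F C) ?m" "F C 0 \<in> H" "J C < l" "F C (2 * J C + 1) \<in> H" "C = cycle_edges (F C) ?m"
    if "C \<in> copies_through H l" for C
    using P[OF that] by (auto simp: F_def J_def)
  define W where "W j x = (\<Union>b\<in>V. walks V j x b)" for j x
  have finW: "finite (W j x)" for j x using finite_V finite_walks by (simp add: W_def)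
  have cardW: "card (W j x) \<le> R ^ j" for j x
  proof -
    have "card (W j x) \<le> (\<Sum>b\<in>V. num_walks V j x b)"
      unfolding W_def using finite_V by (intro order_trans[OF card_UN_le sum_mono] card_walks_le)
    then show ?thesis using sum_num_walks_right[OF R, of j x] by simp
  qed
  \<comment> \<open>The forward list covers the positions 0 to 2j and the backward list the
    positions from 2l down to 2j+2, position 2l being 0 again; position 2j+1 is recorded
    separately.\<close>
  define \<Psi> where "\<Psi> = (\<lambda>C. (J C, F C 0, F C (2 * J C + 1), map (F C) [0..<2 * J C + 1],
    map (reparam (F C) ?m 0 (-1)) [0..<2 * (l - 1 - J C) + 1]))"
  let ?T = "SIGMA j:{..<l}. SIGMA x:H. H \<times> W j x \<times> W (l - 1 - j) x"
  have inW: "map h [0..<2 * j + 1] \<in> W j (h 0)" if h: "is_cycle h ?m" and j: "j < l" for h j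
  proof -
    have "map h [0..<2 * j + 1] \<in> walks V j (h 0) (h (2 * j))"
    proof (rule map_in_walks)
      show "adj (h i) (h (Suc i))" if "i < 2 * j" for i
      proof -
        have "Suc i mod ?m = Suc i" "i < ?m" using that j by auto
        then show ?thesis using h unfolding is_cycle_def by metis
      qed
      show "h (2 * i) \<noteq> h (2 * i + 2)" if "i < j" for i
      proof
        assume "h (2 * i) = h (2 * i + 2)"
        then have "2 * i = 2 * i + 2"
          using h that j unfolding is_cycle_def by (elim conjE inj_onD) auto
        then show False by simp
      qed
    qed (use is_cycle_in_V[OF h] j in auto)
    then show ?thesis using is_cycle_in_V[OF h, of "2 * j"] j by (auto simp: W_def)
  qed
  have sub: "\<Psi> ` copies_through H l \<subseteq> ?T"
  proof (rule image_subsetI)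
    fix C assume C: "C \<in> copies_through H l"
    have "reparam (F C) ?m 0 (-1) 0 = F C 0" by (simp add: reparam_def per_def)
    then have "map (reparam (F C) ?m 0 (-1)) [0..<2 * (l - 1 - J C) + 1] \<in> W (l - 1 - J C) (F C 0)"
      using inW[OF is_cycle_reparam[OF F(1)[OF C] m0], of "-1" "l - 1 - J C" 0] l by simp
    then show "\<Psi> C \<in> ?T"
      unfolding \<Psi>_def using F[OF C] inW[OF F(1)[OF C], of "J C"] by (intro SigmaI) simp_all
  qed
  have inj: "inj_on \<Psi> (copies_through H l)"
  proof (rule inj_onI)
    fix C C' assume C: "C \<in> copies_through H l" "C' \<in> copies_through H l" and eq: "\<Psi> C = \<Psi> C'"
    have J: "J C = J C'" and mid: "F C (2 * J C + 1) = F C' (2 * J C + 1)"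
      using eq by (auto simp: \<Psi>_def)
    have left: "F C i = F C' i" if "i \<le> 2 * J C" for i
    proof -
      have "map (F C) [0..<2 * J C + 1] = map (F C') [0..<2 * J C + 1]"
        using eq J by (simp add: \<Psi>_def)
      then show ?thesis using that by (auto simp: list_eq_iff_nth_eq simp del: upt_Suc)
    qed
    have right: "reparam (F C) ?m 0 (-1) i = reparam (F C') ?m 0 (-1) i" if "i \<le> 2 * (l - 1 - J C)" for i
    proof -
      have "map (reparam (F C) ?m 0 (-1)) [0..<2 * (l - 1 - J C) + 1] = map (reparam (F C') ?m 0 (-1)) [0..<2 * (l - 1 - J C) + 1]"
        using eq J by (simp add: \<Psi>_def)
      then show ?thesis using that by (auto simp: list_eq_iff_nth_eq simp del: upt_Suc)
    qed
    have "F C i = F C' i" if i: "i < ?m" for i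
    proof -
      consider "i \<le> 2 * J C" | "i = 2 * J C + 1" | "i \<ge> 2 * J C + 2" by linarith
      then show ?thesis
      proof cases
        case 3
        \<comment> \<open>Position i is reached after 2l - i steps backwards from 0.\<close>
        have "(0 + (-1) * int (?m - i)) mod int ?m = int i mod int ?m"
          using i by (simp add: mod_eq_dvd_iff of_nat_diff)
        then have "reparam f ?m 0 (-1) (?m - i) = f i" for f :: "nat \<Rightarrow> 'a"
          unfolding reparam_def using i by (simp only: per_def) simp
        then show ?thesis using right[of "?m - i"] 3 i by auto
      qed (use left mid in auto)
    qed
    then have "cycle_edges (F C) ?m = cycle_edges (F C') ?m" by (rule cycle_edges_cong)
    then show "C = C'" using F(5) C by metis
  qed
  have "finite ?T" using finH finW by auto
  then have "card (copies_through H l) \<le> card ?T" by (rule card_inj_on_le[OF inj sub])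
  also have "\<dots> = (\<Sum>j<l. \<Sum>x\<in>H. card H * (card (W j x) * card (W (l - 1 - j) x)))"
    using finH finW by (simp add: card_cartesian_product)
  also have "\<dots> \<le> (\<Sum>j<l. \<Sum>x\<in>H. card H * (R ^ j * R ^ (l - 1 - j)))"
    by (intro sum_mono mult_le_mono cardW le_refl)
  also have "\<dots> = (\<Sum>j<l. \<Sum>x\<in>H. card H * R ^ (l - 1))"
    by (intro sum.cong refl) (auto simp flip: power_add)
  finally show ?thesis by (simp add: power2_eq_square)
qed

end

context even_cycle_free
begin

text \<open>Either one parity class of a cycle is light, and a shift by one makes it the even class,
  or both classes contain heavy vertices, and a rotation puts a heavy vertex at position 0. The two
  cases give the main term and the term of order n^(l-1).\<close>

lemma card_copies_le:
  assumes l: "l \<ge> 2" and q: "q > 0"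
  shows "2 * l * card (copies (2 * l)) \<le> ((k - 1) * card V + 2 * k * (card V div q)) ^ (l - 2) * quad_bound q
    + 2 * l * (l * (4 * k * q\<^sup>2)\<^sup>2 * (3 * k * card V) ^ (l - 1))"
proof -
  let ?m = "2 * l" and ?L = "light q" and ?H = "V - light q"
  have m0: "?m > 0" using l by simp
  have "copies ?m \<subseteq> copies_in ?L l \<union> copies_through ?H l"
  proof
    fix C assume "C \<in> copies ?m"
    then obtain f where f: "is_cycle f ?m" "C = cycle_edges f ?m" by (auto simp: copies_def)
    have re: "C = cycle_edges (reparam f ?m c 1) ?m" "is_cycle (reparam f ?m c 1) ?m" for c
      using f m0 cycle_edges_reparam[of ?m 1 f c] is_cycle_reparam[of f ?m 1 c] by auto
    consider "\<forall>i<l. f (2 * i) \<in> ?L" | "\<forall>i<l. f (2 * i + 1) \<in> ?L"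
      | a b where "a < l" "b < l" "f (2 * a) \<notin> ?L" "f (2 * b + 1) \<notin> ?L" by blast
    then show "C \<in> copies_in ?L l \<union> copies_through ?H l"
    proof cases
      case 1
      then show ?thesis using f by (auto simp: copies_in_def)
    next
      case 2
      have "reparam f ?m 1 1 (2 * i) = f (2 * i + 1)" if "i < l" for i
        using that per_of_nat[of "2 * i + 1" ?m f] by (simp add: reparam_def add.commute)
      then have "\<forall>i<l. reparam f ?m 1 1 (2 * i) \<in> ?L" using 2 by simp
      then show ?thesis using re[of 1] by (auto simp: copies_in_def)
    next
      case (3 a b)
      let ?h = "reparam f ?m (2 * int a) 1"
      have h0: "?h 0 = f (2 * a)"
        using 3 per_of_nat[of "2 * a" ?m f] by (simp add: reparam_def)
      \<comment> \<open>Seen from position 2a, position 2b+1 is number 2j+1 with j = b - a modulo l;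
        adding l - a keeps the subtraction in the naturals.\<close>
      define j where "j = (b + (l - a)) mod l"
      have "b + (l - a) = j + l * ((b + (l - a)) div l)" by (simp add: j_def)
      then have "int b + (int l - int a) = int j + int l * int ((b + (l - a)) div l)"
        using 3(1) by (metis of_nat_add of_nat_mult of_nat_diff less_imp_le)
      then have "(2 * int a + 1 * int (2 * j + 1)) - int (2 * b + 1) = int ?m * (1 - int ((b + (l - a)) div l))"
        by (simp add: algebra_simps)
      then have "(2 * int a + 1 * int (2 * j + 1)) mod int ?m = int (2 * b + 1) mod int ?m"
        by (simp only: mod_eq_dvd_iff dvd_triv_left)
      then have "?h (2 * j + 1) = per f ?m (int (2 * b + 1))"
        unfolding reparam_def by (rule per_cong)
      also have "\<dots> = f (2 * b + 1)" using 3 by (intro per_of_nat) simp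
      finally have hj: "?h (2 * j + 1) = f (2 * b + 1)" .
      have "j < l" using l by (simp add: j_def)
      moreover have "f (2 * a) \<in> ?H" "f (2 * b + 1) \<in> ?H"
        using 3 is_cycle_in_V[OF f(1)] by auto
      ultimately show ?thesis using re[of "2 * int a"] h0 hj unfolding copies_through_def
        by (metis (mono_tags, lifting) UnI2 mem_Collect_eq)
    qed
  qed
  moreover have "finite (copies_in ?L l \<union> copies_through ?H l)"
  proof -
    have "copies_in ?L l \<union> copies_through ?H l \<subseteq> Pow (Pow V)"
      using is_cycle_in_V by (fastforce simp: copies_in_def copies_through_def cycle_edges_def)
    then show ?thesis using finite_V finite_subset by blast
  qed
  ultimately have "card (copies ?m) \<le> card (copies_in ?L l) + card (copies_through ?H l)"
    using card_mono card_Un_le le_trans by metis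
  then have "2 * l * card (copies ?m) \<le> 2 * l * card (copies_in ?L l) + 2 * l * card (copies_through ?H l)"
    by (metis add_mult_distrib2 mult_le_mono2)
  also have "2 * l * card (copies_in ?L l) \<le> ((k - 1) * card V + 2 * k * (card V div q)) ^ (l - 2) * quad_bound q"
  proof -
    have "2 * l * card (copies_in ?L l) \<le> (\<Sum>a\<in>V. num_walks ?L (l - 2 + 2) a a)"
      using card_copies_in_le[OF l, of ?L] le_add_diff_inverse2[OF l] by (simp only:)
    also have "\<dots> \<le> ((k - 1) * card V + 2 * k * (card V div q)) ^ (l - 2) * (\<Sum>a\<in>V. \<Sum>b\<in>V - {a}. (codeg a b)\<^sup>2)"
      by (intro sum_closed_walks_le sum_step_le cherries_light_le)
    also have "\<dots> \<le> ((k - 1) * card V + 2 * k * (card V div q)) ^ (l - 2) * quad_bound q"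
      by (intro mult_le_mono2 sum_codeg_square_le_quad_bound q)
    finally show ?thesis .
  qed
  also have "2 * l * card (copies_through ?H l) \<le> 2 * l * (l * (4 * k * q\<^sup>2)\<^sup>2 * (3 * k * card V) ^ (l - 1))"
  proof (rule mult_le_mono2)
    have "card (copies_through ?H l) \<le> l * (card ?H)\<^sup>2 * (3 * k * card V) ^ (l - 1)"
      using l finite_V by (intro card_copies_through_le sum_step_le cherries_le_uniform) auto
    also have "\<dots> \<le> l * (4 * k * q\<^sup>2)\<^sup>2 * (3 * k * card V) ^ (l - 1)"
      using card_heavy_le[OF q] by (intro mult_le_mono1 mult_le_mono2 power_mono) auto
    finally show "card (copies_through ?H l) \<le> l * (4 * k * q\<^sup>2)\<^sup>2 * (3 * k * card V) ^ (l - 1)" .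
  qed
  finally show ?thesis by simp
qed

end

subsection \<open>The upper bound\<close>

lemma ugraph_of_simple_graph:
  assumes "simple_graph n E"
  shows "ugraph {..<n} (\<lambda>u v. {u, v} \<in> E)"
proof
  fix u v :: nat
  show "{v, u} \<in> E" if "{u, v} \<in> E" using that by (simp add: insert_commute)
  show "{v, v} \<notin> E" using assms by (auto simp: simple_graph_def doubleton_eq_iff)
  show "u \<in> {..<n}" if "{u, v} \<in> E" using assms that by (force simp: simple_graph_def doubleton_eq_iff)
qed simp

lemma cycle_copies_conv:
  assumes "simple_graph n E"
  shows "cycle_copies m E = ugraph.copies (\<lambda>u v. {u, v} \<in> E) m"
proof -
  interpret ugraph "{..<n}" "\<lambda>u v. {u, v} \<in> E" by (rule ugraph_of_simple_graph[OF assms])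
  have "cycle_edges f m \<subseteq> E \<longleftrightarrow> (\<forall>i<m. {f i, f (Suc i mod m)} \<in> E)" for f
    by (auto simp: cycle_edges_def)
  then show ?thesis unfolding cycle_copies_def copies_def is_cycle_def by blast
qed

lemma even_cycle_free_of_simple_graph:
  assumes "simple_graph n E" "cycle_copies (2 * k) E = {}" "k \<ge> 2"
  shows "even_cycle_free {..<n} (\<lambda>u v. {u, v} \<in> E) k"
proof -
  interpret ugraph "{..<n}" "\<lambda>u v. {u, v} \<in> E" by (rule ugraph_of_simple_graph[OF assms(1)])
  show ?thesis
  proof
    fix f :: "nat \<Rightarrow> nat"
    assume "inj_on f {..<2 * k}" "\<And>i. i < 2 * k \<Longrightarrow> {f i, f (Suc i mod (2 * k))} \<in> E"
    then have "cycle_edges f (2 * k) \<in> cycle_copies (2 * k) E"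
      unfolding cycle_copies_def cycle_edges_def by blast
    then show False using assms(2) by simp
  qed (rule assms(3))
qed

lemma finite_ex_cyc_set: "finite {card (cycle_copies (2 * l) E) | E. simple_graph n E \<and> cycle_copies (2 * k) E = {}}"
proof -
  have "{E. simple_graph n E} \<subseteq> Pow (Pow {..<n})"
    by (fastforce simp: simple_graph_def)
  then have "finite {E. simple_graph n E}" by (rule finite_subset) simp
  then show ?thesis by (rule finite_surj[of _ _ "\<lambda>E. card (cycle_copies (2 * l) E)"]) auto
qed

lemma ex_cyc_ge:
  assumes "simple_graph n E" "cycle_copies (2 * k) E = {}"
  shows "card (cycle_copies (2 * l) E) \<le> ex_cyc n l k"
  unfolding ex_cyc_def using assms by (intro Max_ge finite_ex_cyc_set) blast

lemma ex_cyc_attained: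
  assumes "k > 0"
  obtains E where "simple_graph n E" "cycle_copies (2 * k) E = {}" "ex_cyc n l k = card (cycle_copies (2 * l) E)"
proof -
  let ?S = "{card (cycle_copies (2 * l) E) | E. simple_graph n E \<and> cycle_copies (2 * k) E = {}}"
  have "simple_graph n {}" "cycle_copies (2 * k) ({} :: nat set set) = {}"
    using assms by (auto simp: simple_graph_def cycle_copies_def cycle_edges_def lessThan_empty_iff)
  then have "?S \<noteq> {}" by blast
  then have "Max ?S \<in> ?S" by (intro Max_in finite_ex_cyc_set)
  then show ?thesis using that unfolding ex_cyc_def by blast
qed

lemma ex_cyc_upper:
  assumes k: "k \<ge> 2" and l: "l \<ge> 2" and q: "q > 0"
  shows "2 * l * ex_cyc n l k \<le> ((k - 1) * n + 2 * k * (n div q)) ^ (l - 2) *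
    ((2 * k - 3) * (n * ((k - 1) * n + 2 * k * (n div q)) + 4 * k * q\<^sup>2 * (3 * k * n))
     + (2 * k)\<^sup>2 * (1 + k\<^sup>2) * (n * (n div q) + 4 * k * q\<^sup>2 * n))
    + 2 * l * (l * (4 * k * q\<^sup>2)\<^sup>2 * (3 * k * n) ^ (l - 1))"
proof -
  obtain E where E: "simple_graph n E" "cycle_copies (2 * k) E = {}" "ex_cyc n l k = card (cycle_copies (2 * l) E)"
    using ex_cyc_attained[of k n l] k by auto
  interpret even_cycle_free "{..<n}" "\<lambda>u v. {u, v} \<in> E" k
    by (rule even_cycle_free_of_simple_graph[OF E(1,2) k])
  show ?thesis
    using card_copies_le[OF l q] unfolding E(3) cycle_copies_conv[OF E(1)] quad_bound_def card_lessThan .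
qed

section \<open>From the finite bound to the asymptotic one\<close>

lemma eventually_lower_order_le:
  fixes Y d :: real
  assumes "d > 0" "l > 0"
  shows "eventually (\<lambda>n. Y * real n ^ (l - 1) \<le> d * real n ^ l) sequentially"
proof -
  obtain N :: nat where N: "Y / d \<le> real N" using real_arch_simple by blast
  show ?thesis
  proof (rule eventually_sequentiallyI[of N])
    fix n assume "N \<le> n"
    then have "Y / d \<le> real n" using N by simp
    then have "Y \<le> d * real n" using assms(1) by (simp add: pos_divide_le_eq mult.commute)
    then have "Y * real n ^ (l - 1) \<le> d * real n * real n ^ (l - 1)"
      by (intro mult_right_mono) auto
    also have "\<dots> = d * real n ^ l" using assms(2) by (cases l) auto
    finally show "Y * real n ^ (l - 1) \<le> d * real n ^ l" .
  qed
qed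

text \<open>No error factor appears: the constant obtained in the limit of large q contains 2k-3,
  while the claim allows 2(k-1). One fixed q brings the coefficient of n^l strictly below, and the
  gap swallows the terms of order n^(l-1).\<close>

lemma ex_cyc_asymp_upper:
  assumes k: "k \<ge> 2" and l: "l \<ge> 3"
  shows "eventually (\<lambda>n. real (ex_cyc n l k) \<le> real (k - 1) ^ l / real l * real n ^ l) sequentially"
proof -
  have pow_split: "x ^ (l - 2) * x ^ 2 = x ^ l" for x :: real
  proof -
    have "l = (l - 2) + 2" using l by simp
    then show ?thesis by (metis power_add)
  qed
  \<comment> \<open>\<open>\<rho> q\<close> times n bounds the row sums at light vertices, and
    \<open>\<alpha> q\<close> is the resulting coefficient of n^l, with n div q estimated by
    n/q.\<close>
  define \<rho> where "\<rho> q = real (k - 1) + 2 * real k * (1 / real q)" for q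
  define C where "C = (2 * real k)\<^sup>2 * (1 + (real k)\<^sup>2)"
  define \<alpha> where "\<alpha> q = \<rho> q ^ (l - 2) * (real (2 * k - 3) * \<rho> q + C * (1 / real q))" for q
  have lim1: "(\<lambda>q. 1 / real q) \<longlonglongrightarrow> 0" by (rule lim_1_over_n)
  have lim\<rho>: "\<rho> \<longlonglongrightarrow> real (k - 1) + 2 * real k * 0"
    unfolding \<rho>_def by (intro tendsto_intros lim1)
  have "\<alpha> \<longlonglongrightarrow> (real (k - 1) + 2 * real k * 0) ^ (l - 2) * (real (2 * k - 3) * (real (k - 1) + 2 * real k * 0) + C * 0)"
    unfolding \<alpha>_def by (intro tendsto_intros lim1 lim\<rho>)
  then have "\<alpha> \<longlonglongrightarrow> real (k - 1) ^ (l - 2) * (real (2 * k - 3) * real (k - 1))" by simp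
  moreover have "real (k - 1) ^ (l - 2) * (real (2 * k - 3) * real (k - 1)) < 2 * real (k - 1) ^ l"
  proof -
    have pos: "real (k - 1) > 0" using k by simp
    have "real (2 * k - 3) < 2 * real (k - 1)" using k by (simp add: of_nat_diff)
    then have "real (k - 1) ^ (l - 2) * (real (2 * k - 3) * real (k - 1)) < real (k - 1) ^ (l - 2) * (2 * real (k - 1) * real (k - 1))"
      using pos by (intro mult_strict_left_mono mult_strict_right_mono) auto
    also have "\<dots> = 2 * (real (k - 1) ^ (l - 2) * real (k - 1) ^ 2)" by (simp add: power2_eq_square)
    also have "real (k - 1) ^ (l - 2) * real (k - 1) ^ 2 = real (k - 1) ^ l"
      by (rule pow_split)
    finally show ?thesis .
  qed
  ultimately have "eventually (\<lambda>q. \<alpha> q < 2 * real (k - 1) ^ l) sequentially"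
    by (rule order_tendstoD)
  then have "eventually (\<lambda>q. \<alpha> q < 2 * real (k - 1) ^ l \<and> q > 0) sequentially"
    using eventually_gt_at_top by (rule eventually_conj)
  then obtain q where q: "\<alpha> q < 2 * real (k - 1) ^ l" "q > 0"
    using eventually_happens'[OF sequentially_bot] by blast
  \<comment> \<open>M bounds the number of heavy vertices; Y collects everything that carries only
    n^(l-1).\<close>
  define M where "M = 4 * real k * (real q)\<^sup>2"
  define Y where "Y = \<rho> q ^ (l - 2) * (real (2 * k - 3) * (M * (3 * real k)) + C * M)
    + 2 * real l * (real l * M\<^sup>2 * (3 * real k) ^ (l - 1))"
  have bound: "2 * real l * real (ex_cyc n l k) \<le> \<alpha> q * real n ^ l + Y * real n ^ (l - 1)" for n
  proof -
    define D where "D = real (n div q)"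
    have "real (n div q * q) \<le> real n" by (simp only: of_nat_le_iff div_times_less_eq_dividend)
    then have D: "0 \<le> D" "D \<le> real n * (1 / real q)"
      using q(2) by (simp_all add: D_def field_simps)
    have R: "real (k - 1) * real n + 2 * real k * D \<le> \<rho> q * real n"
      using D mult_left_mono[OF D(2), of "2 * real k"] by (simp add: \<rho>_def algebra_simps)
    have \<rho>0: "\<rho> q \<ge> 0" by (simp add: \<rho>_def)
    have C0: "C \<ge> 0" by (simp add: C_def)
    have M0: "M \<ge> 0" by (simp add: M_def)
    have "2 * real l * real (ex_cyc n l k) = real (2 * l * ex_cyc n l k)" by simp
    also have "\<dots> \<le> real (((k - 1) * n + 2 * k * (n div q)) ^ (l - 2) *
      ((2 * k - 3) * (n * ((k - 1) * n + 2 * k * (n div q)) + 4 * k * q\<^sup>2 * (3 * k * n))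
       + (2 * k)\<^sup>2 * (1 + k\<^sup>2) * (n * (n div q) + 4 * k * q\<^sup>2 * n))
      + 2 * l * (l * (4 * k * q\<^sup>2)\<^sup>2 * (3 * k * n) ^ (l - 1)))"
      using ex_cyc_upper[OF k, of l q n] l q by (simp only: of_nat_le_iff)
    also have "\<dots> = (real (k - 1) * real n + 2 * real k * D) ^ (l - 2) *
      (real (2 * k - 3) * (real n * (real (k - 1) * real n + 2 * real k * D) + M * (3 * real k * real n))
       + C * (real n * D + M * real n))
      + 2 * real l * (real l * M\<^sup>2 * (3 * real k * real n) ^ (l - 1))"
      unfolding D_def M_def C_def
      by (simp only: of_nat_add of_nat_mult of_nat_power of_nat_numeral of_nat_1)
    also have "\<dots> \<le> (\<rho> q * real n) ^ (l - 2) *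
      (real (2 * k - 3) * (real n * (\<rho> q * real n) + M * (3 * real k * real n))
       + C * (real n * (real n * (1 / real q)) + M * real n))
      + 2 * real l * (real l * M\<^sup>2 * (3 * real k * real n) ^ (l - 1))"
      using R D \<rho>0 C0 M0
      by (intro add_mono mult_mono power_mono order_refl mult_left_mono add_nonneg_nonneg mult_nonneg_nonneg) auto
    also have "\<dots> = \<alpha> q * (real n ^ (l - 2) * real n ^ 2) + Y * real n ^ (l - 1)"
    proof -
      have "real n ^ (l - 1) = real n ^ (l - 2) * real n"
        using l power_Suc2[of "real n" "l - 2"] by (simp add: Suc_diff_Suc numeral_2_eq_2)
      then show ?thesis
        by (simp add: \<alpha>_def Y_def power_mult_distrib power2_eq_square algebra_simps)
    qed
    also have "real n ^ (l - 2) * real n ^ 2 = real n ^ l"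
      by (rule pow_split)
    finally show ?thesis .
  qed
  have "eventually (\<lambda>n. Y * real n ^ (l - 1) \<le> (2 * real (k - 1) ^ l - \<alpha> q) * real n ^ l) sequentially"
    using q l by (intro eventually_lower_order_le) auto
  then show ?thesis
  proof eventually_elim
    case (elim n)
    then have "2 * real l * real (ex_cyc n l k) \<le> 2 * real (k - 1) ^ l * real n ^ l"
      using bound[of n] by (simp add: algebra_simps)
    then show ?case using l by (simp add: field_simps)
  qed
qed

subsection \<open>The lower bounds\<close>

lemma eventually_shifted_power_ge:
  fixes \<epsilon> c :: real
  assumes "\<epsilon> > 0"
  shows "eventually (\<lambda>n. (1 - \<epsilon>) * real n ^ l \<le> (real n - c) ^ l) sequentially"
proof -
  have "(\<lambda>n. (1 - c * (1 / real n)) ^ l) \<longlonglongrightarrow> (1 - c * 0) ^ l"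
    by (intro tendsto_intros lim_1_over_n)
  then have "(\<lambda>n. (1 - c * (1 / real n)) ^ l) \<longlonglongrightarrow> 1" by simp
  then have "eventually (\<lambda>n. 1 - \<epsilon> < (1 - c * (1 / real n)) ^ l) sequentially"
    using assms by (intro order_tendstoD) auto
  then show ?thesis using eventually_gt_at_top[of 0]
  proof eventually_elim
    case (elim n)
    have "(1 - \<epsilon>) * real n ^ l \<le> (1 - c * (1 / real n)) ^ l * real n ^ l"
      using elim by (intro mult_right_mono) auto
    also have "\<dots> = ((1 - c * (1 / real n)) * real n) ^ l" by (simp add: power_mult_distrib)
    also have "(1 - c * (1 / real n)) * real n = real n - c" using elim by (simp add: field_simps)
    finally show ?case .
  qed
qed

lemma prod_falling_conv:
  assumes "l \<le> N"
  shows "real (\<Prod>{N - l + 1..N}) = (\<Prod>i<l. real N - real i)"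
proof -
  have "(\<Prod>i<l. real N - real i) = (\<Prod>j\<in>{N - l + 1..N}. real j)"
    using assms by (intro prod.reindex_bij_witness[of _ "\<lambda>j. N - j" "\<lambda>i. N - i"]) (auto simp: of_nat_diff)
  then show ?thesis by simp
qed

text \<open>Every edge changes the side, so from offset 0 or 1 every second vertex of the cycle lies
  in S. Both lower-bound constructions are shown to be free of cycles by looking at these vertices
  only.\<close>

lemma (in ugraph) bipartite_cycle:
  assumes "\<And>x y. adj x y \<Longrightarrow> S x \<longleftrightarrow> \<not> S y" "is_cycle f m" "m > 0"
  obtains b where "\<And>i :: nat. S (per f m (2 * int i + b))"
proof -
  have flip: "S (per f m (x + 1)) \<longleftrightarrow> \<not> S (per f m x)" for x
    using assms(1)[OF is_cycle_adj[OF assms(2,3), of x]] by blast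
  have shift: "S (per f m (2 * int i + x)) \<longleftrightarrow> S (per f m x)" for i x
  proof (induction i)
    case (Suc i)
    have "2 * int (Suc i) + x = (2 * int i + x + 1) + 1" by simp
    then show ?case using Suc flip by metis
  qed simp
  show ?thesis
  proof (cases "S (per f m 0)")
    case True
    then show ?thesis using that[of 0] shift[of _ 0] by blast
  next
    case False
    then have "S (per f m 1)" using flip[of 0] by simp
    then show ?thesis using that[of 1] shift[of _ 1] by blast
  qed
qed

text \<open>A vertex of a cycle lies on only two of its edges. One leads back to the vertex already
  placed, so the next vertex is forced; the edge set and a directed first edge thus fix the
  parametrization.\<close>

lemma cycle_edges_determined:
  assumes f: "inj_on f {..<m}" and g: "inj_on g {..<m}"
    and eq: "cycle_edges f m = cycle_edges g m" and start: "f 0 = g 0" "f 1 = g 1"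
    and i: "i < m"
  shows "f i = g i"
proof -
  have "Suc i < m \<longrightarrow> f i = g i \<and> f (Suc i) = g (Suc i)" for i
  proof (induction i)
    case 0
    then show ?case using start by simp
  next
    case (Suc i)
    show ?case
    proof
      assume i: "Suc (Suc i) < m"
      then have IH: "f i = g i" "f (Suc i) = g (Suc i)" using Suc by auto
      have "{g (Suc i), g (Suc (Suc i) mod m)} \<in> cycle_edges f m"
        unfolding eq unfolding cycle_edges_def using i by (intro image_eqI[of _ _ "Suc i"]) auto
      then obtain j where j: "j < m" "{f (Suc i), g (Suc (Suc i))} = {f j, f (Suc j mod m)}"
        using i IH by (auto simp: cycle_edges_def)
      then consider "f (Suc i) = f j" "g (Suc (Suc i)) = f (Suc j mod m)"
        | "f (Suc i) = f (Suc j mod m)" "g (Suc (Suc i)) = f j"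
        by (auto simp: doubleton_eq_iff)
      then have "g (Suc (Suc i)) = f (Suc (Suc i))"
      proof cases
        case 1
        then have "j = Suc i" using inj_onD[OF f 1(1)] i j(1) by auto
        then show ?thesis using 1 i by simp
      next
        case 2
        then have "Suc i = Suc j mod m" using inj_onD[OF f 2(1)] i j(1) by auto
        then have "j = i" using j(1) by (cases "Suc j = m") auto
        then have "g (Suc (Suc i)) = g i" using 2 IH by simp
        then show ?thesis using inj_onD[OF g] i by fastforce
      qed
      then show "f (Suc i) = g (Suc i) \<and> f (Suc (Suc i)) = g (Suc (Suc i))" using IH by simp
    qed
  qed
  then show ?thesis using i start(1) by (cases i) auto
qed

definition complete_bip :: "nat \<Rightarrow> nat \<Rightarrow> nat set set" where
  "complete_bip s n = {{u, v} | u v. u < s \<and> s \<le> v \<and> v < n}"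

lemma complete_bip_iff: "{x, y} \<in> complete_bip s n \<longleftrightarrow> (x < s \<and> s \<le> y \<and> y < n) \<or> (y < s \<and> s \<le> x \<and> x < n)"
  unfolding complete_bip_def by (auto simp: doubleton_eq_iff)

lemma simple_graph_complete_bip: "simple_graph n (complete_bip s n)"
  unfolding simple_graph_def complete_bip_def by fastforce

lemma inj_on_interleave:
  fixes as bs :: "'a list"
  defines "h \<equiv> \<lambda>i. if even i then as ! (i div 2) else bs ! (i div 2)"
  assumes "distinct as" "distinct bs" "length as = l" "length bs = l" "set as \<inter> set bs = {}"
  shows "inj_on h {..<2 * l}"
proof (rule inj_onI)
  fix i j assume ij: "i \<in> {..<2 * l}" "j \<in> {..<2 * l}" "h i = h j"
  then have d: "i div 2 < l" "j div 2 < l" by auto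
  have "as ! t \<noteq> bs ! t'" if "t < l" "t' < l" for t t'
    using that assms(4-6) by (metis disjoint_iff nth_mem)
  then have "even i \<longleftrightarrow> even j"
    using ij(3) d unfolding h_def by metis
  moreover have "i div 2 = j div 2"
    using ij(3) d assms(2-5) calculation by (auto simp: h_def nth_eq_iff_index_eq split: if_splits)
  ultimately show "i = j" by (metis even_two_times_div_two odd_two_times_div_two_succ)
qed

lemma finite_cycle_copies: "finite E \<Longrightarrow> finite (cycle_copies m E)"
  by (rule finite_subset[of _ "Pow E"]) (auto simp: cycle_copies_def)

lemma finite_simple_graph: "simple_graph n E \<Longrightarrow> finite E"
  by (rule finite_subset[of _ "Pow {..<n}"]) (force simp: simple_graph_def)+

text \<open>Two lists of l distinct vertices, one from each side, are interleaved to a cycle. Each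
  cycle arises at most 2l times, once per choice of its first edge.\<close>

lemma card_complete_bip_copies:
  assumes l: "2 \<le> l" "l \<le> s" "l \<le> n - s"
  shows "\<Prod>{n - s - l + 1..n - s} * \<Prod>{s - l + 1..s} \<le> 2 * l * card (cycle_copies (2 * l) (complete_bip s n))"
proof -
  let ?E = "complete_bip s n" and ?m = "2 * l"
  define A where "A = {as :: nat list. length as = l \<and> distinct as \<and> set as \<subseteq> {s..<n}}"
  define B where "B = {bs :: nat list. length bs = l \<and> distinct bs \<and> set bs \<subseteq> {..<s}}"
  define h where "h = (\<lambda>(as :: nat list, bs :: nat list) i. if even i then as ! (i div 2) else bs ! (i div 2))"
  have cA: "card A = \<Prod>{n - s - l + 1..n - s}"
    unfolding A_def using card_lists_distinct_length_eq[of "{s..<n}" l] l by simp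
  have cB: "card B = \<Prod>{s - l + 1..s}"
    unfolding B_def using card_lists_distinct_length_eq[of "{..<s}" l] l by simp
  have inj: "inj_on (h p) {..<?m}" if "p \<in> A \<times> B" for p
  proof -
    obtain as bs where p: "p = (as, bs)" by (cases p)
    have "set as \<inter> set bs = {}" using that p by (fastforce simp: A_def B_def)
    then show ?thesis using that p inj_on_interleave[of as bs l] by (auto simp: h_def A_def B_def)
  qed
  have vals: "even i \<Longrightarrow> h p i \<in> {s..<n}" "odd i \<Longrightarrow> h p i \<in> {..<s}" if "p \<in> A \<times> B" "i < ?m" for p i
  proof -
    obtain as bs where p: "p = (as, bs)" by (cases p)
    have "i div 2 < l" using that by auto
    then have "as ! (i div 2) \<in> set as" "bs ! (i div 2) \<in> set bs"
      using that p by (auto simp: A_def B_def)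
    then have "as ! (i div 2) \<in> {s..<n}" "bs ! (i div 2) \<in> {..<s}"
      using that p unfolding A_def B_def by blast+
    then show "even i \<Longrightarrow> h p i \<in> {s..<n}" "odd i \<Longrightarrow> h p i \<in> {..<s}" by (auto simp: h_def p)
  qed
  have copy: "cycle_edges (h p) ?m \<in> cycle_copies ?m ?E" if p: "p \<in> A \<times> B" for p
  proof -
    have "cycle_edges (h p) ?m \<subseteq> ?E"
    proof
      fix e assume "e \<in> cycle_edges (h p) ?m"
      then obtain i where i: "i < ?m" "e = {h p i, h p (Suc i mod ?m)}" by (auto simp: cycle_edges_def)
      have "even (Suc i mod ?m) \<longleftrightarrow> odd i" by (simp add: dvd_mod_iff)
      moreover have "Suc i mod ?m < ?m" using l by simp
      ultimately show "e \<in> ?E"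
        using vals[OF p i(1)] vals[OF p, of "Suc i mod ?m"] unfolding i(2) complete_bip_iff by auto
    qed
    then show ?thesis using inj[OF p] by (auto simp: cycle_copies_def)
  qed
  have fibre: "card {p \<in> A \<times> B. cycle_edges (h p) ?m = C} \<le> ?m" if C: "C \<in> cycle_copies ?m ?E" for C
  proof -
    have cC: "finite C" "card C \<le> ?m"
    proof -
      obtain f where "C = cycle_edges f ?m" using C by (auto simp: cycle_copies_def)
      then show "finite C" "card C \<le> ?m"
        using card_image_le[of "{..<?m}" "\<lambda>i. {f i, f (Suc i mod ?m)}"] by (auto simp: cycle_edges_def)
    qed
    \<comment> \<open>Even positions always lie in the large part, so the unordered first edge
      already tells which end is \<open>h p 0\<close> and which is \<open>h p 1\<close>.\<close>
    have inj: "inj_on (\<lambda>p. {h p 0, h p 1}) {p \<in> A \<times> B. cycle_edges (h p) ?m = C}"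
    proof (rule inj_onI)
      fix p p' assume *: "p \<in> {p \<in> A \<times> B. cycle_edges (h p) ?m = C}" "p' \<in> {p \<in> A \<times> B. cycle_edges (h p) ?m = C}"
        and eq: "{h p 0, h p 1} = {h p' 0, h p' 1}"
      then have p: "p \<in> A \<times> B" "p' \<in> A \<times> B" "cycle_edges (h p) ?m = cycle_edges (h p') ?m" by auto
      have "h p 0 = h p' 0 \<and> h p 1 = h p' 1"
        using eq vals[OF p(1), of 0] vals[OF p(1), of 1] vals[OF p(2), of 0] vals[OF p(2), of 1] l
        by (auto simp: doubleton_eq_iff)
      then have same: "h p i = h p' i" if "i < ?m" for i
        using cycle_edges_determined[OF inj[OF p(1)] inj[OF p(2)] p(3)] that by blast
      obtain as bs as' bs' where pp: "p = (as, bs)" "p' = (as', bs')" by (metis prod.exhaust)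
      have len: "length as = l" "length as' = l" "length bs = l" "length bs' = l"
        using p pp by (auto simp: A_def B_def)
      have "as = as'"
        using len same[of "2 * _"] by (intro nth_equalityI) (auto simp: h_def pp)
      moreover have "bs = bs'"
        using len same[of "2 * _ + 1"] by (intro nth_equalityI) (auto simp: h_def pp)
      ultimately show "p = p'" using pp by simp
    qed
    have "(\<lambda>p. {h p 0, h p 1}) ` {p \<in> A \<times> B. cycle_edges (h p) ?m = C} \<subseteq> C"
      using l by (force simp: cycle_edges_def)
    then show ?thesis using card_inj_on_le[OF inj _ cC(1)] cC(2) by simp
  qed
  have fin: "finite (cycle_copies ?m ?E)"
    by (intro finite_cycle_copies finite_simple_graph[OF simple_graph_complete_bip])
  have "A \<times> B = (\<Union>C\<in>cycle_copies ?m ?E. {p \<in> A \<times> B. cycle_edges (h p) ?m = C})"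
    using copy by auto
  then have "card (A \<times> B) = card (\<Union>C\<in>cycle_copies ?m ?E. {p \<in> A \<times> B. cycle_edges (h p) ?m = C})"
    by (rule arg_cong)
  also have "\<dots> \<le> (\<Sum>C\<in>cycle_copies ?m ?E. card {p \<in> A \<times> B. cycle_edges (h p) ?m = C})"
    by (rule card_UN_le[OF fin])
  also have "\<dots> \<le> card (cycle_copies ?m ?E) * ?m"
    using fibre by (rule sum_bounded_above[of _ _ ?m, unfolded of_nat_id])
  finally show ?thesis by (simp add: card_cartesian_product cA cB mult_ac)
qed

text \<open>The vertices below l are the unblown ones, in cyclic order. A vertex v from l on is a
  copy of the vertex between \<open>v mod l\<close> and its successor modulo l, so the copies are
  the residue classes.\<close>

definition blown_cycle :: "nat \<Rightarrow> nat \<Rightarrow> nat set set" where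
  "blown_cycle l n = (\<lambda>v. {v, v mod l}) ` {l..<n} \<union> (\<lambda>v. {v, Suc v mod l}) ` {l..<n}"

lemma blown_cycle_small:
  assumes "{x, y} \<in> blown_cycle l n" "x < l"
  shows "l \<le> y \<and> (x = y mod l \<or> x = Suc y mod l)"
  using assms by (auto simp: blown_cycle_def doubleton_eq_iff)

lemma blown_cycle_bipartite:
  assumes "{x, y} \<in> blown_cycle l n" "l > 0"
  shows "x < l \<longleftrightarrow> \<not> y < l"
proof -
  have "v mod l < l" for v using assms(2) by simp
  then show ?thesis using assms by (auto simp: blown_cycle_def doubleton_eq_iff)
qed

lemma simple_graph_blown_cycle:
  assumes "l > 0"
  shows "simple_graph n (blown_cycle l n)"
proof -
  have "\<exists>u w. {v, t mod l} = {u, w} \<and> u \<noteq> w \<and> u < n \<and> w < n" if "l \<le> v" "v < n" for v t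
  proof -
    have "t mod l < l" using assms by simp
    then show ?thesis using that by (intro exI[of _ v] exI[of _ "t mod l"]) auto
  qed
  then show ?thesis by (auto simp: simple_graph_def blown_cycle_def)
qed

text \<open>The small vertices of a cycle walk around Z/l by steps 1 and -1; as they are distinct, the
  direction never changes, so the walk must close up after a multiple of \<open>l\<close> steps.\<close>

lemma blown_cycle_free:
  assumes kl: "3 \<le> k" "k < l"
  shows "cycle_copies (2 * k) (blown_cycle l n) = {}"
proof (rule ccontr)
  let ?E = "blown_cycle l n" and ?m = "2 * k"
  have l0: "l > 0" using kl by simp
  interpret ugraph "{..<n}" "\<lambda>u v. {u, v} \<in> ?E"
    by (intro ugraph_of_simple_graph simple_graph_blown_cycle l0)
  assume "cycle_copies ?m ?E \<noteq> {}"
  then obtain f where f: "is_cycle f ?m"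
    unfolding cycle_copies_conv[OF simple_graph_blown_cycle[OF l0]] copies_def by blast
  have m0: "?m > 0" using kl by simp
  obtain b where b: "\<And>i. per f ?m (2 * int i + b) < l"
    using bipartite_cycle[of "\<lambda>x. x < l" f ?m] blown_cycle_bipartite[OF _ l0] f m0 by blast
  define u where "u i = per f ?m (2 * int i + b)" for i :: nat
  have u_less: "u i < l" for i using b by (simp add: u_def)
  have u_eq_iff: "u i = u j \<longleftrightarrow> int ?m dvd 2 * int i - 2 * int j" for i j
    by (simp add: u_def is_cycle_per_eq_iff[OF f m0] mod_eq_dvd_iff)
  have u_neq: "u i \<noteq> u (i + d)" if "0 < d" "d < k" for i d
  proof
    assume "u i = u (i + d)"
    then have "int ?m dvd 2 * int d" by (simp add: u_eq_iff algebra_simps)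
    then show False using that zdvd_imp_le[of "int ?m" "2 * int d"] by simp
  qed
  \<comment> \<open>A common neighbour w has only the small neighbours \<open>w mod l\<close> and
    \<open>Suc w mod l\<close>; two distinct small vertices joined through w are therefore
    cyclically consecutive.\<close>
  have step: "\<exists>s\<in>{1, -1}. int (u (Suc i)) mod int l = (int (u i) + s) mod int l" for i
  proof -
    define w where "w = per f ?m (2 * int i + b + 1)"
    have 1: "{u i, w} \<in> ?E" unfolding u_def w_def by (rule is_cycle_adj[OF f m0])
    have "{w, u (Suc i)} \<in> ?E"
      using is_cycle_adj[OF f m0, of "2 * int i + b + 1"] by (simp add: u_def w_def algebra_simps)
    then have 2: "{u (Suc i), w} \<in> ?E" by (simp add: insert_commute)
    have "u i \<noteq> u (Suc i)" using u_neq[of 1 i] kl by simp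
    then consider "u i = w mod l" "u (Suc i) = Suc w mod l" | "u (Suc i) = w mod l" "u i = Suc w mod l"
      using blown_cycle_small[OF 1 u_less] blown_cycle_small[OF 2 u_less] by metis
    then show ?thesis
    proof cases
      case 1
      then have "int (u (Suc i)) mod int l = (int (u i) + 1) mod int l"
        by (simp add: zmod_int mod_simps add.commute)
      then show ?thesis by blast
    next
      case 2
      then have "(int (u i) + -1) mod int l = int (u (Suc i)) mod int l"
        by (simp add: zmod_int mod_simps)
      then show ?thesis by (metis insertCI)
    qed
  qed
  obtain s :: int where s: "s \<in> {1, -1}" "int (u 1) mod int l = (int (u 0) + s) mod int l"
    using step[of 0] unfolding One_nat_def by blast
  have walk: "int (u i) mod int l = (int (u 0) + s * int i) mod int l
    \<and> int (u (Suc i)) mod int l = (int (u 0) + s * int (Suc i)) mod int l" for i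
  proof (induction i)
    case 0
    then show ?case using s by simp
  next
    case (Suc i)
    obtain s' where s': "s' \<in> {1, -1}" "int (u (Suc (Suc i))) mod int l = (int (u (Suc i)) + s') mod int l"
      using step[of "Suc i"] by blast
    have eq: "int (u (Suc (Suc i))) mod int l = (int (u 0) + s * int (Suc i) + s') mod int l"
      using s'(2) Suc by (metis mod_add_left_eq)
    have "s' = s"
    proof (rule ccontr)
      \<comment> \<open>A change of direction would return to \<open>u i\<close> after two steps,
        which is impossible because 2 < k.\<close>
      assume "s' \<noteq> s"
      then have "s' = - s" using s(1) s'(1) by auto
      then have "int (u (Suc (Suc i))) mod int l = int (u i) mod int l"
        using eq Suc by (simp add: algebra_simps)
      then have "u (i + 2) = u i" using u_less by simp
      then show False using u_neq[of 2 i] kl by simp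
    qed
    then show ?case using eq Suc by (simp add: algebra_simps)
  qed
  have "u k = u 0" by (simp add: u_eq_iff)
  then have "int (u 0) mod int l = (int (u 0) + s * int k) mod int l" using walk[of k] by simp
  then have "int l dvd s * int k" by (simp add: mod_eq_dvd_iff)
  then have "int l dvd int k" using s(1) by auto
  then show False using kl zdvd_imp_le[of "int l" "int k"] by simp
qed

text \<open>One copy is chosen in each residue class, giving l independent choices. The large
  vertices of the cycle have pairwise different residues, so the choices can be read off from the
  edge set.\<close>

lemma card_blown_cycle_copies:
  assumes l: "l \<ge> 2"
  shows "(n div l - 1) ^ l \<le> card (cycle_copies (2 * l) (blown_cycle l n))"
proof -
  let ?E = "blown_cycle l n" and ?m = "2 * l"
  define X where "X = {xs :: nat list. set xs \<subseteq> {..<n div l - 1} \<and> length xs = l}"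
  \<comment> \<open>\<open>p xs i\<close> is the copy number \<open>xs ! i\<close> in residue class
    i, counted from l upwards. Numbers below \<open>n div l - 1\<close> stay below n, since l + i +
    l*t is less than l*(t+2).\<close>
  define p where "p xs i = l + i + l * (xs ! i)" for xs :: "nat list" and i
  define h where "h xs i = (if even i then i div 2 else p xs (i div 2))" for xs i
  have p: "p xs i \<ge> l" "p xs i < n" "p xs i mod l = i" if "xs \<in> X" "i < l" for xs i
  proof -
    have "xs ! i \<in> set xs" using that by (auto simp: X_def)
    moreover have "set xs \<subseteq> {..<n div l - 1}" using that by (simp add: X_def)
    ultimately have "xs ! i < n div l - 1" by blast
    then have "l * (xs ! i + 2) \<le> l * (n div l)" by (intro mult_le_mono2) simp
    also have "\<dots> \<le> n" by simp
    finally show "p xs i < n" using that by (simp add: p_def)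
    show "p xs i \<ge> l" "p xs i mod l = i" using that by (auto simp: p_def)
  qed
  have copy: "cycle_edges (h xs) ?m \<in> cycle_copies ?m ?E" if xs: "xs \<in> X" for xs
  proof -
    have "inj_on (h xs) {..<?m}"
    proof (rule inj_onI)
      fix i j assume ij: "i \<in> {..<?m}" "j \<in> {..<?m}" "h xs i = h xs j"
      then have d: "i div 2 < l" "j div 2 < l" by auto
      have "even i \<longleftrightarrow> even j"
        using ij d p(1)[OF xs d(1)] p(1)[OF xs d(2)] by (auto simp: h_def split: if_splits)
      moreover have "i div 2 = j div 2"
        using ij(3) calculation p(3)[OF xs d(1)] p(3)[OF xs d(2)] unfolding h_def by metis
      ultimately show "i = j" by (metis even_two_times_div_two odd_two_times_div_two_succ)
    qed
    moreover have "cycle_edges (h xs) ?m \<subseteq> ?E"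
    proof
      fix e assume "e \<in> cycle_edges (h xs) ?m"
      then obtain i where i: "i < ?m" "e = {h xs i, h xs (Suc i mod ?m)}" by (auto simp: cycle_edges_def)
      have d: "i div 2 < l" using i by auto
      let ?v = "p xs (i div 2)"
      have v: "?v \<in> {l..<n}" using p[OF xs d] by simp
      show "e \<in> ?E"
      proof (cases "even i")
        case True
        then have "Suc i < ?m" using i by (auto elim!: evenE)
        then have "e = {?v, ?v mod l}" using i True p(3)[OF xs d] by (simp add: h_def insert_commute)
        then show ?thesis using v by (auto simp: blown_cycle_def)
      next
        case False
        then obtain t where t: "i = 2 * t + 1" by (rule oddE)
        have "Suc i mod ?m = 2 * (Suc t mod l)" using t by (simp add: mult_mod_right)
        then have "h xs (Suc i mod ?m) = Suc t mod l" by (simp add: h_def)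
        also have "\<dots> = Suc ?v mod l"
          using p(3)[OF xs d] t mod_Suc_eq[of ?v l] by simp
        finally have "e = {?v, Suc ?v mod l}" using i False by (simp add: h_def)
        then show ?thesis using v by (auto simp: blown_cycle_def)
      qed
    qed
    ultimately show ?thesis by (auto simp: cycle_copies_def)
  qed
  have "inj_on (\<lambda>xs. cycle_edges (h xs) ?m) X"
  proof (rule inj_onI)
    fix xs ys assume xy: "xs \<in> X" "ys \<in> X" "cycle_edges (h xs) ?m = cycle_edges (h ys) ?m"
    show "xs = ys"
    proof (rule nth_equalityI)
      show "length xs = length ys" using xy by (simp add: X_def)
      fix i assume "i < length xs"
      then have i: "i < l" using xy by (simp add: X_def)
      have "p xs i \<in> \<Union>(cycle_edges (h xs) ?m)"
        unfolding cycle_edges_def using i by (intro UnionI[OF imageI[of "2 * i + 1"]]) (auto simp: h_def)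
      then have "p xs i \<in> \<Union>(cycle_edges (h ys) ?m)" using xy by simp
      then obtain x where x: "x < ?m" "p xs i = h ys x \<or> p xs i = h ys (Suc x mod ?m)"
        by (auto simp: cycle_edges_def)
      moreover have "Suc x mod ?m < ?m" using l by simp
      ultimately obtain j where j: "j < ?m" "p xs i = h ys j" by blast
      have d: "j div 2 < l" using j by auto
      have "odd j" using j d p(1)[OF xy(1) i] by (auto simp: h_def)
      then have pj: "p xs i = p ys (j div 2)" using j by (simp add: h_def)
      then have "j div 2 = i" using p(3)[OF xy(1) i] p(3)[OF xy(2) d] by simp
      then show "xs ! i = ys ! i" using pj l by (simp add: p_def)
    qed
  qed
  moreover have "(\<lambda>xs. cycle_edges (h xs) ?m) ` X \<subseteq> cycle_copies ?m ?E" using copy by blast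
  moreover have "finite (cycle_copies ?m ?E)"
    using l by (intro finite_cycle_copies finite_simple_graph[OF simple_graph_blown_cycle]) simp
  ultimately have "card X \<le> card (cycle_copies ?m ?E)" by (rule card_inj_on_le)
  moreover have "card X = (n div l - 1) ^ l"
    unfolding X_def using card_lists_length_eq[of "{..<n div l - 1}" l] by simp
  ultimately show ?thesis by simp
qed

text \<open>A cycle on 2k vertices would need k vertices in the part of size k-1.\<close>

lemma complete_bip_free:
  assumes "k > 0"
  shows "cycle_copies (2 * k) (complete_bip (k - 1) n) = {}"
proof (rule ccontr)
  let ?E = "complete_bip (k - 1) n" and ?m = "2 * k"
  interpret ugraph "{..<n}" "\<lambda>u v. {u, v} \<in> ?E"
    by (rule ugraph_of_simple_graph[OF simple_graph_complete_bip])
  have m0: "?m > 0" using assms by simp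
  assume "cycle_copies ?m ?E \<noteq> {}"
  then obtain f where f: "is_cycle f ?m"
    unfolding cycle_copies_conv[OF simple_graph_complete_bip] copies_def by blast
  have bip: "x < k - 1 \<longleftrightarrow> \<not> y < k - 1" if "{x, y} \<in> ?E" for x y
    using that unfolding complete_bip_iff by auto
  obtain b where b: "\<And>i. per f ?m (2 * int i + b) < k - 1"
    using bipartite_cycle[of "\<lambda>x. x < k - 1" f ?m] bip f m0 by blast
  have "inj_on (\<lambda>i. per f ?m (2 * int i + b)) {..<k}"
  proof (rule inj_onI)
    fix i j assume ij: "i \<in> {..<k}" "j \<in> {..<k}" "per f ?m (2 * int i + b) = per f ?m (2 * int j + b)"
    then have "int ?m dvd 2 * int i - 2 * int j"
      by (simp add: is_cycle_per_eq_iff[OF f m0] mod_eq_dvd_iff)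
    then have "(2 * int i) mod int ?m = (2 * int j) mod int ?m" by (simp only: mod_eq_dvd_iff)
    then show "i = j" using ij by simp
  qed
  then have "card {..<k} \<le> card {..<k - 1}"
    by (rule card_inj_on_le) (use b in auto)
  then show False using assms by simp
qed

lemma ex_cyc_asymp_lower_complete_bip:
  fixes \<epsilon> :: real
  assumes l: "2 \<le> l" "l < k" and "\<epsilon> > 0"
  shows "eventually (\<lambda>n. (1 - \<epsilon>) * ((\<Prod>i<l. real (k - 1) - real i) / (2 * real l)) * real n ^ l
    \<le> real (ex_cyc n l k)) sequentially"
proof -
  let ?P = "\<Prod>i<l. real (k - 1) - real i"
  have P0: "?P \<ge> 0" using l by (intro prod_nonneg) auto
  have "eventually (\<lambda>n. (1 - \<epsilon>) * real n ^ l \<le> (real n - real (k + l)) ^ l) sequentially"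
    by (rule eventually_shifted_power_ge[OF assms(3)])
  then show ?thesis using eventually_ge_at_top[of "k + l"]
  proof eventually_elim
    case (elim n)
    let ?N = "n - (k - 1)"
    have "real (\<Prod>{?N - l + 1..?N} * \<Prod>{k - 1 - l + 1..k - 1}) \<le> real (2 * l * card (cycle_copies (2 * l) (complete_bip (k - 1) n)))"
      unfolding of_nat_le_iff using l elim by (intro card_complete_bip_copies) auto
    also have "\<dots> \<le> real (2 * l * ex_cyc n l k)"
      unfolding of_nat_le_iff using l
      by (intro mult_le_mono2 ex_cyc_ge simple_graph_complete_bip complete_bip_free) auto
    finally have "(\<Prod>i<l. real ?N - real i) * ?P \<le> 2 * real l * real (ex_cyc n l k)"
      using prod_falling_conv[of l ?N] prod_falling_conv[of l "k - 1"] l elim by (simp only: of_nat_mult)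
    \<comment> \<open>Each factor n - (k-1) - i with i < l is at least n - (k+l), which turns the
      falling product into a shifted power.\<close>
    moreover have "(real n - real (k + l)) ^ l \<le> (\<Prod>i<l. real ?N - real i)"
    proof -
      have "(real n - real (k + l)) ^ l = (\<Prod>i<l. real n - real (k + l))" by simp
      also have "\<dots> \<le> (\<Prod>i<l. real ?N - real i)"
        using elim l by (intro prod_mono) (auto simp: of_nat_diff)
      finally show ?thesis .
    qed
    ultimately have "(1 - \<epsilon>) * real n ^ l * ?P \<le> 2 * real l * real (ex_cyc n l k)"
      using elim(1) P0 by (meson mult_right_mono order_trans)
    then show ?case using l by (simp add: field_simps)
  qed
qed

lemma ex_cyc_asymp_lower_blown_cycle:
  fixes \<epsilon> :: real
  assumes kl: "3 \<le> k" "k < l" and "\<epsilon> > 0"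
  shows "eventually (\<lambda>n. (1 - \<epsilon>) * (1 / real l ^ l) * real n ^ l \<le> real (ex_cyc n l k)) sequentially"
proof -
  have "eventually (\<lambda>n. (1 - \<epsilon>) * real n ^ l \<le> (real n - 2 * real l) ^ l) sequentially"
    by (rule eventually_shifted_power_ge[OF assms(3)])
  then show ?thesis using eventually_ge_at_top[of "2 * l"]
  proof eventually_elim
    case (elim n)
    have l0: "l > 0" using kl by simp
    have "n < l * (n div l) + l"
      using mult_div_mod_eq[of l n] mod_less_divisor[OF l0, of n] by linarith
    moreover have "n div l \<ge> 1" using elim(2) l0 by (simp add: Suc_le_eq div_greater_zero_iff)
    then have "l * (n div l - 1) + l = l * (n div l)" by (cases "n div l") auto
    ultimately have "n \<le> l * (n div l - 1) + 2 * l" by linarith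
    then have "real n \<le> real (l * (n div l - 1) + 2 * l)" by (simp only: of_nat_le_iff)
    then have "real n - 2 * real l \<le> real l * real (n div l - 1)" by simp
    then have "(real n - 2 * real l) ^ l \<le> (real l * real (n div l - 1)) ^ l"
      using elim(2) by (intro power_mono) auto
    also have "\<dots> = real l ^ l * real ((n div l - 1) ^ l)" by (simp add: power_mult_distrib)
    also have "\<dots> \<le> real l ^ l * real (card (cycle_copies (2 * l) (blown_cycle l n)))"
      using kl card_blown_cycle_copies[of l n] by (intro mult_left_mono) (simp_all only: of_nat_le_iff, auto)
    also have "\<dots> \<le> real l ^ l * real (ex_cyc n l k)"
      using ex_cyc_ge[OF simple_graph_blown_cycle[OF l0] blown_cycle_free[OF kl], of l n]
      by (intro mult_left_mono) auto
    finally have "(1 - \<epsilon>) * real n ^ l \<le> real l ^ l * real (ex_cyc n l k)" using elim(1) by linarith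
    then show ?case using l0 by (simp add: field_simps)
  qed
qed

theorem theorem8:
  fixes k l :: nat
  shows "(3 \<le> l \<and> 2 \<le> k \<longrightarrow>
           (\<forall>\<epsilon>>0. \<forall>\<^sub>F n in sequentially.
              real (ex_cyc n l k) \<le> (1 + \<epsilon>) * (2 ^ (l - 2) * real (k - 1) ^ l / (2 * real l)) * real n ^ l))
       \<and> (l \<ge> 2 \<and> k > l \<longrightarrow>
           (\<forall>\<epsilon>>0. \<forall>\<^sub>F n in sequentially.
              real (ex_cyc n l k) \<ge> (1 - \<epsilon>) * ((\<Prod>i<l. real (k - 1) - real i) / (2 * real l)) * real n ^ l))
       \<and> (k \<ge> 3 \<and> l > k \<longrightarrow>
           (\<forall>\<epsilon>>0. \<forall>\<^sub>F n in sequentially.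
              real (ex_cyc n l k) \<ge> (1 - \<epsilon>) * (1 / real l ^ l) * real n ^ l))"
proof (intro conjI impI allI)
  fix \<epsilon> :: real
  assume kl: "3 \<le> l \<and> 2 \<le> k" and "\<epsilon> > 0"
  \<comment> \<open>This is where l at least 3 enters: 2^(l-2) is at least 2, so (k-1)^l / l is at
    most the claimed constant.\<close>
  have "(2 :: real) ^ 1 \<le> 2 ^ (l - 2)" using kl by (intro power_increasing) auto
  then have "2 * 1 \<le> 2 ^ (l - 2) * (1 + \<epsilon>)"
    using \<open>\<epsilon> > 0\<close> by (intro mult_mono) auto
  then have "real (k - 1) ^ l / (2 * real l) * (2 * 1) \<le> real (k - 1) ^ l / (2 * real l) * (2 ^ (l - 2) * (1 + \<epsilon>))"
    by (intro mult_left_mono) auto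
  then have const: "real (k - 1) ^ l / real l \<le> (1 + \<epsilon>) * (2 ^ (l - 2) * real (k - 1) ^ l / (2 * real l))"
    by (simp add: mult_ac)
  have "\<forall>\<^sub>F n in sequentially. real (ex_cyc n l k) \<le> real (k - 1) ^ l / real l * real n ^ l"
    using kl by (intro ex_cyc_asymp_upper) auto
  then show "\<forall>\<^sub>F n in sequentially.
    real (ex_cyc n l k) \<le> (1 + \<epsilon>) * (2 ^ (l - 2) * real (k - 1) ^ l / (2 * real l)) * real n ^ l"
  proof eventually_elim
    case (elim n)
    note elim
    also have "real (k - 1) ^ l / real l * real n ^ l
        \<le> (1 + \<epsilon>) * (2 ^ (l - 2) * real (k - 1) ^ l / (2 * real l)) * real n ^ l"
      by (intro mult_right_mono const) simp
    finally show ?case .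
  qed
next
  fix \<epsilon> :: real
  assume "l \<ge> 2 \<and> k > l" and "\<epsilon> > 0"
  then show "\<forall>\<^sub>F n in sequentially.
    real (ex_cyc n l k) \<ge> (1 - \<epsilon>) * ((\<Prod>i<l. real (k - 1) - real i) / (2 * real l)) * real n ^ l"
    using ex_cyc_asymp_lower_complete_bip by blast
next
  fix \<epsilon> :: real
  assume "k \<ge> 3 \<and> l > k" and "\<epsilon> > 0"
  then show "\<forall>\<^sub>F n in sequentially. real (ex_cyc n l k) \<ge> (1 - \<epsilon>) * (1 / real l ^ l) * real n ^ l"
    using ex_cyc_asymp_lower_blown_cycle by blast
qed

end
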